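(* Let $d\geq 1$ and let $f:\mathbb{Z}^{d}\to\mathbb{R}$ be a function in $\ell^{1}(\mathbb{Z}^{d})$. Then $$\operatorname{Var} \widetilde{M}f\leq \widetilde{C}(d)\,\|f\|_{\ell^{1}(\mathbb{Z}^{d})},\qquad \widetilde{C}(d):=2d\left(1+\sum_{k\geq 1}\frac{1}{k}\left(\left(\frac{2}{k+1}+\frac{2k-1}{k}\right)^{d-1}-\left(\frac{2k-1}{k}\right)^{d-1}\right)\right),$$ and the constant $\widetilde{C}(d)$ is the best possible (i.e. it is the smallest constant $C$ such that $\operatorname{Var} \widetilde{M}f\le C\|f\|_{\ell^1(\mathbb{Z}^d)}$ for all $f\in\ell^1(\mathbb{Z}^d)$). Moreover, equality $\operatorname{Var} \widetilde{M}f=\widetilde{C}(d)\|f\|_{\ell^1(\mathbb{Z}^d)}$ is attained if and only if $f$ is a delta function.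
   Context: For $f:\mathbb{Z}^d\to\mathbb{R}$: $\|f\|_{\ell^1(\mathbb{Z}^d)}=\sum_{\vec n\in\mathbb{Z}^d}|f(\vec n)|$, and the total variation is $\operatorname{Var} f=\sum_{i=1}^d\sum_{\vec n\in\mathbb{Z}^d}|f(\vec n+\vec e_i)-f(\vec n)|$, where $\vec e_i$ is the $i$-th canonical basis vector. For $\vec x\in\mathbb{R}^d$ write $\|\vec x\|_\infty=\max\{|x_1|,\dots,|x_d|\}$. The discrete uncentered maximal operator associated to cubes ($\ell^\infty$-balls) is $$\widetilde{M}f(\vec n)=\sup\ \frac{1}{N(\vec x_0,r)}\sum_{\vec m\in\mathbb{Z}^d,\ \|\vec m-\vec x_0\|_\infty\le r}|f(\vec m)|,\qquad \vec n\in\mathbb{Z}^d,$$ where the supremum is over all real centers $\vec x_0\in\mathbb{R}^d$ and real radii $r\ge 0$ with $\|\vec n-\vec x_0\|_\infty\le r$, and $N(\vec x_0,r)$ is the number of $\vec m\in\mathbb{Z}^d$ with $\|\vec m-\vec x_0\|_\infty\le r$. A function $f:\mathbb{Z}^d\to\mathbb{R}$ is a delta function if there exist $\vec p\in\mathbb{Z}^d$ and $k\in\mathbb{R}$ such that $f(\vec p)=k$ and $f(\vec n)=0$ for all $\vec n\in\mathbb{Z}^d\setminus\{\vec p\}$ (the value $k=0$ is allowed). *)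

theory Defs
  imports "HOL-Analysis.Analysis"
begin

definition lattice_embed :: "int ^ 'd \<Rightarrow> real ^ 'd" where
  "lattice_embed n = (\<chi> i. real_of_int (n $ i))"

(* The library's infnorm is the maximum norm; see infnorm_cart and infnorm_Max. *)
definition cube :: "real ^ 'd \<Rightarrow> real \<Rightarrow> (int ^ 'd) set" where
  "cube x\<^sub>0 r = {m. infnorm (lattice_embed m - x\<^sub>0) \<le> r}"

definition cube_average :: "(int ^ 'd \<Rightarrow> real) \<Rightarrow> real ^ 'd \<Rightarrow> real \<Rightarrow> real" where
  "cube_average f x\<^sub>0 r = (\<Sum>m\<in>cube x\<^sub>0 r. \<bar>f m\<bar>) / real (card (cube x\<^sub>0 r))"

(* Real-valued supremum: meaningful for bounded f, in particular for every summable f. *)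
definition uncentered_maximal :: "(int ^ 'd \<Rightarrow> real) \<Rightarrow> int ^ 'd \<Rightarrow> real" where
  "uncentered_maximal f n =
     (SUP (x\<^sub>0, r) \<in> {(x\<^sub>0, r). r \<ge> 0 \<and> n \<in> cube x\<^sub>0 r}. cube_average f x\<^sub>0 r)"

(* Valued in ennreal, so that a divergent variation is infinity rather than 0. *)
definition total_variation :: "(int ^ 'd \<Rightarrow> real) \<Rightarrow> ennreal" where
  "total_variation f =
     (\<Sum>i\<in>UNIV. \<Sum>\<^sub>\<infinity>n. ennreal \<bar>f (n + axis i 1) - f n\<bar>)"

definition ell1 :: "(int ^ 'd \<Rightarrow> real) set" where
  "ell1 = {f. (\<lambda>n. \<bar>f n\<bar>) summable_on UNIV}"

definition ell1_norm :: "(int ^ 'd \<Rightarrow> real) \<Rightarrow> real" where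
  "ell1_norm f = (\<Sum>\<^sub>\<infinity>n. \<bar>f n\<bar>)"

definition delta_function :: "(int ^ 'd \<Rightarrow> real) \<Rightarrow> bool" where
  "delta_function f \<longleftrightarrow> (\<exists>p k. f p = k \<and> (\<forall>n. n \<noteq> p \<longrightarrow> f n = 0))"

definition sharp_const :: "nat \<Rightarrow> real" where
  "sharp_const d = 2 * real d *
     (1 + (\<Sum>\<^sub>\<infinity>k\<in>{1::nat..}. 1 / real k *
        ((2 / (real k + 1) + (2 * real k - 1) / real k) ^ (d - 1)
          - ((2 * real k - 1) / real k) ^ (d - 1))))"

end

theory Submission
  imports Defs
begin

text \<open>
  For a unit point mass the maximal function at offset \<open>y\<close> is the inverse of the least number of lattice
  points in a cube containing both points, called \<open>weight y\<close> below; along a coordinate line it is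
  unimodal, so the variation on that line is twice its peak, and summing the peaks over all lines,
  shell by shell in the maximum norm, gives the sharp constant.

  For general \<open>f\<close>, the maximal function on a line attains its value at \<open>t\<close> as the average over some cube
  \<open>Q t\<close>, and it is at least that large on all of \<open>Q t\<close>. Hence the cubes of distinct local maxima meet
  the line in disjoint intervals (the minimum in between lies in neither), and since a point of \<open>Q t\<close>
  projects along the line direction into \<open>Q t\<close>, the cubes themselves are disjoint. So each
  lattice point contributes to one local maximum only, and at most \<open>\<bar>f m\<bar>\<close> times the peak of the point
  mass at \<open>m\<close>. If \<open>f\<close> has two support points \<open>p \<noteq> q\<close>, a line through \<open>p\<close> loses a positive amount: either
  one of them is missed, or they share a cube, which then has more than one point, or they lie in
  different cubes and the local minimum in between is positive.
\<close>

subsection \<open>Infinite sums of extended nonnegative reals\<close>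

text \<open>Reduces unconditional sums to finite partial sums, so that no summability has to be
  tracked for values in \<open>ennreal\<close>.\<close>

lemma infsum_ennreal_SUP:
  fixes f :: "'a \<Rightarrow> ennreal"
  shows "infsum f A = (SUP F\<in>{F. finite F \<and> F \<subseteq> A}. sum f F)"
  by (rule nonneg_infsum_complete) simp

lemma infsum_ennreal_mono2:
  fixes f :: "'a \<Rightarrow> ennreal"
  assumes "A \<subseteq> B"
  shows "infsum f A \<le> infsum f B"
  unfolding infsum_ennreal_SUP by (rule SUP_subset_mono) (use assms in auto)

lemma infsum_ennreal_cmult:
  fixes f :: "'a \<Rightarrow> ennreal"
  shows "(\<Sum>\<^sub>\<infinity>x\<in>A. c * f x) = c * infsum f A"
  unfolding infsum_ennreal_SUP sum_distrib_left [symmetric]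
  by (rule SUP_mult_left_ennreal [symmetric])

lemma ennreal_infsum:
  assumes "f summable_on A" "\<And>x. x \<in> A \<Longrightarrow> 0 \<le> f x"
  shows "(\<Sum>\<^sub>\<infinity>x\<in>A. ennreal (f x)) = ennreal (infsum f A)"
proof -
  have "ennreal (infsum f A) = (SUP F\<in>{F. finite F \<and> F \<subseteq> A}. ennreal (sum f F))"
    by (rule infsum_nonneg_is_SUPREMUM_ennreal [OF assms])
  also have "\<dots> = (\<Sum>\<^sub>\<infinity>x\<in>A. ennreal (f x))"
    unfolding infsum_ennreal_SUP
    by (intro SUP_cong refl sum_ennreal [symmetric]) (use assms(2) in auto)
  finally show ?thesis by simp
qed

text \<open>Tonelli without summability hypotheses. For finitely many fibres it is additivity; any
  finite part of the Sigma set meets only finitely many fibres.\<close>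

lemma infsum_Sigma_ennreal:
  fixes f :: "'a \<times> 'b \<Rightarrow> ennreal"
  shows "infsum f (Sigma A B) = (\<Sum>\<^sub>\<infinity>x\<in>A. \<Sum>\<^sub>\<infinity>y\<in>B x. f (x, y))"
proof (rule antisym)
  let ?h = "\<lambda>x. \<Sum>\<^sub>\<infinity>y\<in>B x. f (x, y)"
  have partial: "infsum f (Sigma G B) = sum ?h G" if "finite G" for G
    using that
  proof (induction G)
    case (insert x G)
    have "infsum f (Sigma (insert x G) B) = infsum f (Pair x ` B x \<union> Sigma G B)"
      by (rule arg_cong [of _ _ "infsum f"]) auto
    also have "\<dots> = infsum f (Pair x ` B x) + infsum f (Sigma G B)"
      by (rule infsum_Un_disjoint) (use insert.hyps in \<open>auto intro: nonneg_summable_on_complete\<close>)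
    also have "infsum f (Pair x ` B x) = ?h x"
      by (subst infsum_reindex) (auto simp: inj_on_def o_def)
    finally show ?case using insert by simp
  qed simp
  show "infsum f (Sigma A B) \<le> infsum ?h A"
    unfolding infsum_ennreal_SUP [of f]
  proof (rule SUP_least, clarify)
    fix F assume F: "finite F" "F \<subseteq> Sigma A B"
    have "sum f F = infsum f F" using F by simp
    also have "\<dots> \<le> infsum f (Sigma (fst ` F) B)"
      by (rule infsum_ennreal_mono2) (use F in force)
    also have "\<dots> = sum ?h (fst ` F)" using F by (simp add: partial)
    also have "\<dots> \<le> infsum ?h A"
      unfolding infsum_ennreal_SUP [of ?h] by (rule SUP_upper) (use F in auto)
    finally show "sum f F \<le> infsum ?h A" .
  qed
  show "infsum ?h A \<le> infsum f (Sigma A B)"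
    unfolding infsum_ennreal_SUP [of ?h]
  proof (rule SUP_least, clarify)
    fix G assume G: "finite G" "G \<subseteq> A"
    then have "sum ?h G = infsum f (Sigma G B)" by (simp add: partial)
    also have "\<dots> \<le> infsum f (Sigma A B)"
      by (rule infsum_ennreal_mono2) (use G in auto)
    finally show "sum ?h G \<le> infsum f (Sigma A B)" .
  qed
qed

lemma infsum_swap_ennreal:
  fixes f :: "'a \<Rightarrow> 'b \<Rightarrow> ennreal"
  shows "(\<Sum>\<^sub>\<infinity>x\<in>A. \<Sum>\<^sub>\<infinity>y\<in>B. f x y) = (\<Sum>\<^sub>\<infinity>y\<in>B. \<Sum>\<^sub>\<infinity>x\<in>A. f x y)"
proof -
  have "(\<Sum>\<^sub>\<infinity>x\<in>A. \<Sum>\<^sub>\<infinity>y\<in>B. f x y) = (\<Sum>\<^sub>\<infinity>(x, y)\<in>A \<times> B. f x y)"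
    by (simp add: infsum_Sigma_ennreal)
  also have "\<dots> = (\<Sum>\<^sub>\<infinity>(y, x)\<in>B \<times> A. f x y)"
    by (rule infsum_reindex_bij_witness [of _ prod.swap prod.swap]) auto
  finally show ?thesis
    by (simp add: infsum_Sigma_ennreal)
qed

subsection \<open>Variation on a line and disjoint plateaus\<close>

text \<open>The selected \<open>t\<close> play the role of the local maxima. Going from \<open>b\<close> to \<open>b + 1\<close>, an increase either
  opens a new interval starting at \<open>b + 1\<close>, with the valley \<open>b\<close> before it, or replaces the element whose
  interval reaches beyond \<open>b\<close>. The valley clause keeps a gain that does not depend on \<open>a\<close> and \<open>b\<close>.\<close>

lemma disjoint_interval_selection:
  fixes g :: "int \<Rightarrow> real" and l r :: "int \<Rightarrow> int"
  assumes nonneg: "\<And>t. 0 \<le> g t"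
    and around: "\<And>t. l t \<le> t \<and> t \<le> r t"
    and plateau: "\<And>s t. l t \<le> s \<Longrightarrow> s \<le> r t \<Longrightarrow> g t \<le> g s"
    and "a \<le> b"
  shows "\<exists>T \<subseteq> {a..b}. (\<Sum>t\<in>{a..<b}. \<bar>g (t + 1) - g t\<bar>) + g a + g b \<le> 2 * (\<Sum>t\<in>T. g t) \<and>
    (\<forall>s\<in>T. \<forall>t\<in>T. s < t \<longrightarrow> r s < l t \<and>
      (\<exists>v. r s \<le> v \<and> v \<le> l t \<and>
        (\<Sum>t\<in>{a..<b}. \<bar>g (t + 1) - g t\<bar>) + g a + g b + 2 * g v \<le> 2 * (\<Sum>t\<in>T. g t)))"
  using \<open>a \<le> b\<close>
proof (induction b rule: int_ge_induct)
  case base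
  show ?case by (intro exI [of _ "{a}"]) auto
next
  case (step b)
  \<comment> \<open>The end values make descents free: \<open>V\<close> stays constant when
    \<open>g\<close> falls and grows by twice the rise when \<open>g\<close> rises.\<close>
  define V where "V b = (\<Sum>t\<in>{a..<b}. \<bar>g (t + 1) - g t\<bar>) + g a + g b" for b
  from step.IH obtain T where T: "T \<subseteq> {a..b}" "V b \<le> 2 * sum g T"
    and sep: "\<And>s t. s \<in> T \<Longrightarrow> t \<in> T \<Longrightarrow> s < t \<Longrightarrow> r s < l t"
    and valley: "\<And>s t. s \<in> T \<Longrightarrow> t \<in> T \<Longrightarrow> s < t \<Longrightarrow>
      \<exists>v. r s \<le> v \<and> v \<le> l t \<and> V b + 2 * g v \<le> 2 * sum g T"
    unfolding V_def by blast
  have fin: "finite T" using T(1) finite_subset by blast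
  have "{a..<b + 1} = insert b {a..<b}" using step.hyps by auto
  then have V_step: "V (b + 1) = V b + \<bar>g (b + 1) - g b\<bar> + g (b + 1) - g b"
    by (simp add: V_def)
  have "\<exists>T' \<subseteq> {a..b + 1}. V (b + 1) \<le> 2 * sum g T' \<and>
    (\<forall>s\<in>T'. \<forall>t\<in>T'. s < t \<longrightarrow> r s < l t \<and>
      (\<exists>v. r s \<le> v \<and> v \<le> l t \<and> V (b + 1) + 2 * g v \<le> 2 * sum g T'))"
  proof (cases "g (b + 1) \<le> g b")
    case True
    then have "V (b + 1) = V b" by (simp add: V_step)
    then show ?thesis
      using T sep valley by (intro exI [of _ T]) auto
  next
    case False
    then have V': "V (b + 1) = V b + 2 * g (b + 1) - 2 * g b" by (simp add: V_step)
    \<comment> \<open>If the interval of \<open>b + 1\<close> reached \<open>b\<close>, then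
      \<open>plateau\<close> would give \<open>g (b + 1) \<le> g b\<close>.\<close>
    have l_new: "l (b + 1) = b + 1"
      using plateau [of "b + 1" b] around [of "b + 1"] False by force
    have new: "b + 1 \<notin> T" using T(1) by auto
    show ?thesis
    proof (cases "\<exists>t\<in>T. b + 1 \<le> r t")
      case False
      let ?T = "insert (b + 1) T"
      have sum: "sum g ?T = g (b + 1) + sum g T" using fin new by simp
      show ?thesis
      proof (intro exI [of _ ?T] conjI ballI impI)
        show "?T \<subseteq> {a..b + 1}" using T(1) step.hyps by auto
        show "V (b + 1) \<le> 2 * sum g ?T"
          using T(2) nonneg [of b] by (simp add: sum V')
      next
        fix s t assume st: "s \<in> ?T" "t \<in> ?T" "s < t"
        then have s: "s \<in> T" using T(1) by auto
        show "r s < l t"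
          using st s sep False l_new by force
        show "\<exists>v. r s \<le> v \<and> v \<le> l t \<and> V (b + 1) + 2 * g v \<le> 2 * sum g ?T"
        proof (cases "t = b + 1")
          case True
          \<comment> \<open>The choice of \<open>b\<close> as valley is exact:
            \<open>2 * g b\<close> cancels the negative term in \<open>V'\<close>.\<close>
          then show ?thesis
            using False s l_new T(2) by (intro exI [of _ b]) (force simp: sum V')
        next
          case False
          with st valley [OF s] obtain v where
            "r s \<le> v" "v \<le> l t" "V b + 2 * g v \<le> 2 * sum g T" by auto
          then show ?thesis
            using nonneg [of b] by (intro exI [of _ v]) (auto simp: sum V')
        qed
      qed
    next
      case True
      then obtain t0 where t0: "t0 \<in> T" "b + 1 \<le> r t0" by blast
      have t0_le: "t0 \<le> b" using T(1) t0(1) by auto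
      \<comment> \<open>The interval of \<open>t0\<close> contains \<open>b\<close>, so exchanging
        \<open>t0\<close> for \<open>b + 1\<close> raises the sum by at least
        \<open>g (b + 1) - g b\<close>.\<close>
      have g_t0: "g t0 \<le> g b"
        using plateau [of t0 b] around [of t0] t0 t0_le by linarith
      have before: "s < t0" if "s \<in> T - {t0}" for s
        using sep [of t0 s] that t0 T(1) around [of s] by force
      let ?T = "insert (b + 1) (T - {t0})"
      have sum: "sum g ?T = g (b + 1) + sum g T - g t0"
        using fin new t0 by (simp add: sum_diff1)
      show ?thesis
      proof (intro exI [of _ ?T] conjI ballI impI)
        show "?T \<subseteq> {a..b + 1}" using T(1) step.hyps by auto
        show "V (b + 1) \<le> 2 * sum g ?T"
          using T(2) g_t0 by (simp add: sum V')
      next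
        fix s t assume st: "s \<in> ?T" "t \<in> ?T" "s < t"
        then have s: "s \<in> T" "s < t0" using T(1) before by auto
        \<comment> \<open>The old element that stands in for \<open>t\<close>. Its interval starts
          no later, so separation and valley carry over from \<open>T\<close>.\<close>
        define t' where "t' = (if t = b + 1 then t0 else t)"
        have t': "t' \<in> T" "s < t'" "l t' \<le> l t"
          using st s t0 around [of t0] t0_le l_new by (auto simp: t'_def)
        show "r s < l t"
          using sep [OF s(1) t'(1,2)] t'(3) by linarith
        obtain v where "r s \<le> v" "v \<le> l t'" "V b + 2 * g v \<le> 2 * sum g T"
          using valley [OF s(1) t'(1,2)] by blast
        then show "\<exists>v. r s \<le> v \<and> v \<le> l t \<and> V (b + 1) + 2 * g v \<le> 2 * sum g ?T"
          using g_t0 t'(3) by (intro exI [of _ v]) (auto simp: sum V')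
      qed
    qed
  qed
  then show ?case unfolding V_def .
qed

subsection \<open>Lattice points of cubes\<close>

lemma mem_cube_iff:
  fixes m :: "int ^ 'd"
  shows "m \<in> cube x r \<longleftrightarrow> (\<forall>i. \<bar>real_of_int (m $ i) - x $ i\<bar> \<le> r)"
proof -
  have "{\<bar>(lattice_embed m - x) $ i\<bar> | i. i \<in> UNIV} = range (\<lambda>i. \<bar>real_of_int (m $ i) - x $ i\<bar>)"
    by (auto simp: lattice_embed_def)
  then have "infnorm (lattice_embed m - x) = Max (range (\<lambda>i. \<bar>real_of_int (m $ i) - x $ i\<bar>))"
    unfolding infnorm_cart by (simp add: cSup_eq_Max)
  then show ?thesis by (simp add: cube_def)
qed

text \<open>Transports boxes of vectors to products of sets of functions, where cardinalities and
  sums of products factor.\<close>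

lemma cart_box_eq_image:
  "{m :: 'a ^ 'd. \<forall>i. m $ i \<in> S i} = vec_lambda ` (\<Pi>\<^sub>E i\<in>UNIV. S i)"
proof (intro set_eqI iffI)
  fix m :: "'a ^ 'd" assume "m \<in> {m. \<forall>i. m $ i \<in> S i}"
  then show "m \<in> vec_lambda ` (\<Pi>\<^sub>E i\<in>UNIV. S i)"
    by (intro image_eqI [of _ _ "vec_nth m"]) (auto simp: vec_lambda_eta)
qed auto

lemma inj_vec_lambda: "inj_on vec_lambda A"
  by (rule inj_onI) (simp add: vec_lambda_inject)

lemma sum_prod_cart_box:
  fixes u :: "'d::finite \<Rightarrow> 'a \<Rightarrow> 'b :: comm_semiring_1"
  assumes "\<And>i. finite (S i)"
  shows "(\<Sum>m\<in>{m :: 'a ^ 'd. \<forall>i. m $ i \<in> S i}. \<Prod>i\<in>UNIV. u i (m $ i)) = (\<Prod>i\<in>UNIV. \<Sum>t\<in>S i. u i t)"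
  using assms by (simp add: cart_box_eq_image sum.reindex inj_vec_lambda prod_sum_PiE)

lemma cube_eq_box:
  "cube x r = {m. \<forall>i. m $ i \<in> {\<lceil>x $ i - r\<rceil>..\<lfloor>x $ i + r\<rfloor>}}"
  unfolding mem_cube_iff set_eq_iff by (auto simp: ceiling_le_iff le_floor_iff abs_le_iff)
    (smt (verit))+

lemma finite_cube: "finite (cube x r)"
  unfolding cube_eq_box cart_box_eq_image by (intro finite_imageI finite_PiE) auto

lemma card_cube:
  fixes x :: "real ^ 'd"
  shows "card (cube x r) = (\<Prod>i\<in>UNIV. nat (\<lfloor>x $ i + r\<rfloor> - \<lceil>x $ i - r\<rceil> + 1))"
  unfolding cube_eq_box cart_box_eq_image
  by (subst card_image [OF inj_vec_lambda]) (simp add: card_PiE)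

lemma card_cube_pos: "n \<in> cube x r \<Longrightarrow> 0 < card (cube x r)"
  using finite_cube card_gt_0_iff by blast

lemma abs_diff_less_side:
  fixes m n :: "int ^ 'd"
  assumes "m \<in> cube x r" "n \<in> cube x r"
  shows "\<bar>m $ i - n $ i\<bar> + 1 \<le> \<lfloor>x $ i + r\<rfloor> - \<lceil>x $ i - r\<rceil> + 1"
  using assms unfolding cube_eq_box by (auto dest!: spec [of _ i])

text \<open>Each side count is a factor of the positive cardinality. Thus a cube with few points
  cannot reach far from any of them.\<close>

lemma abs_diff_less_card_cube:
  fixes m n :: "int ^ 'd"
  assumes "m \<in> cube x r" "n \<in> cube x r"
  shows "\<bar>m $ i - n $ i\<bar> + 1 \<le> int (card (cube x r))"
proof -
  have "nat (\<lfloor>x $ i + r\<rfloor> - \<lceil>x $ i - r\<rceil> + 1) dvd card (cube x r)"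
    unfolding card_cube by (rule dvd_prodI) auto
  then have "nat (\<lfloor>x $ i + r\<rfloor> - \<lceil>x $ i - r\<rceil> + 1) \<le> card (cube x r)"
    using card_cube_pos [OF assms(1)] by (rule dvd_imp_le)
  then show ?thesis
    using abs_diff_less_side [OF assms, of i] by linarith
qed

section \<open>Fewest lattice points in a cube through two given points\<close>

definition height :: "int ^ 'd \<Rightarrow> nat" where
  "height y = Max (range (\<lambda>i. nat \<bar>y $ i\<bar>))"

text \<open>A cube containing \<open>0\<close> and \<open>y\<close> has side length at least
  \<open>height y\<close>. An interval of exactly that length can be shifted to hold only
  \<open>height y\<close> integers, except in coordinates where \<open>0\<close> and
  \<open>y $ i\<close> must be its two ends. For \<open>y = 0\<close> every coordinate is of the
  latter kind.\<close>

definition weight :: "int ^ 'd \<Rightarrow> real" where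
  "weight y = (\<Prod>i\<in>UNIV. 1 / real (if nat \<bar>y $ i\<bar> = height y then height y + 1 else height y))"

lemma height_ge: "nat \<bar>y $ i\<bar> \<le> height y"
  unfolding height_def by (rule Max_ge) auto

lemma height_attained: "\<exists>i. nat \<bar>y $ i\<bar> = height y"
proof -
  have "height y \<in> range (\<lambda>i. nat \<bar>y $ i\<bar>)"
    unfolding height_def by (rule Max_in) auto
  then show ?thesis by force
qed

lemma height_le_iff: "height y \<le> k \<longleftrightarrow> (\<forall>i. nat \<bar>y $ i\<bar> \<le> k)"
  by (simp add: height_def)

lemma weight_factor_pos: "0 < (if nat \<bar>y $ i\<bar> = height y then height y + 1 else height y)"
  using height_ge [of y i] by auto

lemma weight_pos: "0 < weight y"
  unfolding weight_def
proof (intro prod_pos ballI)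
  fix i
  show "0 < 1 / real (if nat \<bar>y $ i\<bar> = height y then height y + 1 else height y)"
    using weight_factor_pos [of y i] by simp
qed

lemma weight_le_1: "weight y \<le> 1"
  unfolding weight_def
proof (intro prod_le_1 conjI)
  fix i
  have "1 \<le> real (if nat \<bar>y $ i\<bar> = height y then height y + 1 else height y)"
    using weight_factor_pos [of y i] by linarith
  then show "1 / real (if nat \<bar>y $ i\<bar> = height y then height y + 1 else height y) \<le> 1"
    by simp
qed auto

lemma weight_0: "weight (0 :: int ^ 'd) = 1"
proof -
  have "height (0 :: int ^ 'd) = 0" by (simp add: height_def)
  then show ?thesis by (simp add: weight_def)
qed

text \<open>The side length \<open>2 * r\<close> is at least the height. A coordinate attaining the
  height spans one integer more than the height, and any other side still holds at least as many
  integers as the height.\<close>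

lemma inverse_card_cube_le_weight:
  fixes m n :: "int ^ 'd"
  assumes "m \<in> cube x r" "n \<in> cube x r"
  shows "1 / real (card (cube x r)) \<le> weight (m - n)"
proof -
  let ?y = "m - n"
  obtain i0 where i0: "nat \<bar>?y $ i0\<bar> = height ?y"
    using height_attained by blast
  have "\<bar>real_of_int (m $ i0) - x $ i0\<bar> \<le> r" "\<bar>real_of_int (n $ i0) - x $ i0\<bar> \<le> r"
    using assms by (auto simp: mem_cube_iff)
  moreover have "real (height ?y) = \<bar>real_of_int (m $ i0) - real_of_int (n $ i0)\<bar>"
    unfolding i0 [symmetric] by simp
  ultimately have diam: "real (height ?y) \<le> 2 * r" by linarith
  have side: "(if nat \<bar>?y $ i\<bar> = height ?y then height ?y + 1 else height ?y)
      \<le> nat (\<lfloor>x $ i + r\<rfloor> - \<lceil>x $ i - r\<rceil> + 1)" for i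
  proof (cases "nat \<bar>?y $ i\<bar> = height ?y")
    case True
    then show ?thesis using abs_diff_less_side [OF assms, of i] by (simp flip: True)
  next
    case False
    \<comment> \<open>Rounding loses less than 1 at each end; between integers the strict inequality
      then gains the missing unit.\<close>
    have "real_of_int (int (height ?y)) < real_of_int (\<lfloor>x $ i + r\<rfloor> - \<lceil>x $ i - r\<rceil> + 2)"
      unfolding of_int_add of_int_diff of_int_of_nat_eq of_int_numeral using diam by linarith
    then have "int (height ?y) \<le> \<lfloor>x $ i + r\<rfloor> - \<lceil>x $ i - r\<rceil> + 1"
      unfolding of_int_less_iff by linarith
    with False show ?thesis by simp
  qed
  have "1 / real (card (cube x r)) = (\<Prod>i\<in>UNIV. 1 / real (nat (\<lfloor>x $ i + r\<rfloor> - \<lceil>x $ i - r\<rceil> + 1)))"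
    by (simp add: card_cube prod_dividef)
  also have "\<dots> \<le> weight ?y"
    unfolding weight_def
  proof (intro prod_mono conjI)
    fix i
    show "1 / real (nat (\<lfloor>x $ i + r\<rfloor> - \<lceil>x $ i - r\<rceil> + 1))
        \<le> 1 / real (if nat \<bar>?y $ i\<bar> = height ?y then height ?y + 1 else height ?y)"
      using side [of i] weight_factor_pos [of ?y i]
      by (intro divide_left_mono) (auto simp del: of_nat_Suc intro!: mult_pos_pos)
  qed auto
  finally show ?thesis .
qed

text \<open>The converse of \<open>inverse_card_cube_le_weight\<close>: the bound is optimal, so
  \<open>weight\<close> is exactly the profile of a unit point mass.\<close>

lemma weight_attained:
  fixes m n :: "int ^ 'd"
  obtains x r where "0 \<le> r" "m \<in> cube x r" "n \<in> cube x r"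
    "1 / real (card (cube x r)) = weight (m - n)"
proof
  define h where "h = height (m - n)"
  \<comment> \<open>Off the extremal coordinates the side of length \<open>h\<close> gets half-integer endpoints, so that it
    contains only \<open>h\<close> integers instead of \<open>h + 1\<close>.\<close>
  define x :: "real ^ 'd" where "x = (\<chi> i. if nat \<bar>(m - n) $ i\<bar> = h
    then (real_of_int (m $ i) + real_of_int (n $ i)) / 2
    else real_of_int (min (m $ i) (n $ i)) + (real h - 1) / 2)"
  define r where "r = real h / 2"
  show "0 \<le> r" by (simp add: r_def)
  have ends: "\<lceil>x $ i - r\<rceil> = min (m $ i) (n $ i)"
    "\<lfloor>x $ i + r\<rfloor> = min (m $ i) (n $ i) + int (if nat \<bar>(m - n) $ i\<bar> = h then h else h - 1)"
    "\<bar>m $ i - n $ i\<bar> \<le> int (if nat \<bar>(m - n) $ i\<bar> = h then h else h - 1)"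
    "nat \<bar>(m - n) $ i\<bar> \<noteq> h \<Longrightarrow> 0 < h" for i
  proof -
    have ge: "nat \<bar>(m - n) $ i\<bar> \<le> h" unfolding h_def by (rule height_ge)
    have *: "\<lceil>x $ i - r\<rceil> = min (m $ i) (n $ i) \<and>
      \<lfloor>x $ i + r\<rfloor> = min (m $ i) (n $ i) + int (if nat \<bar>(m - n) $ i\<bar> = h then h else h - 1)"
    proof (cases "nat \<bar>(m - n) $ i\<bar> = h")
      case True
      then have "real h = \<bar>real_of_int (m $ i) - real_of_int (n $ i)\<bar>" by auto
      then have "x $ i - r = real_of_int (min (m $ i) (n $ i))"
        "x $ i + r = real_of_int (min (m $ i) (n $ i) + int h)"
        using True by (auto simp: x_def r_def min_def field_simps)
      then show ?thesis using True by (simp del: of_int_add)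
    next
      case False
      then have "x $ i - r = real_of_int (min (m $ i) (n $ i)) - 1 / 2"
        "x $ i + r = real_of_int (min (m $ i) (n $ i)) + real h - 1 / 2"
        by (auto simp: x_def r_def field_simps)
      then have "\<lceil>x $ i - r\<rceil> = min (m $ i) (n $ i)"
        "\<lfloor>x $ i + r\<rfloor> = min (m $ i) (n $ i) + int h - 1"
        by linarith+
      then show ?thesis using False ge by auto
    qed
    then show "\<lceil>x $ i - r\<rceil> = min (m $ i) (n $ i)"
      "\<lfloor>x $ i + r\<rfloor> = min (m $ i) (n $ i) + int (if nat \<bar>(m - n) $ i\<bar> = h then h else h - 1)"
      by auto
    show "\<bar>m $ i - n $ i\<bar> \<le> int (if nat \<bar>(m - n) $ i\<bar> = h then h else h - 1)"
      "nat \<bar>(m - n) $ i\<bar> \<noteq> h \<Longrightarrow> 0 < h"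
      using ge by auto
  qed
  show "m \<in> cube x r" "n \<in> cube x r"
    unfolding cube_eq_box mem_Collect_eq atLeastAtMost_iff ends(1,2)
    using ends(3) by (smt (verit))+
  \<comment> \<open>\<open>h - 1\<close> is a truncated difference of naturals;
    \<open>ends(4)\<close> excludes \<open>h = 0\<close> off the extremal coordinates.\<close>
  have "nat (\<lfloor>x $ i + r\<rfloor> - \<lceil>x $ i - r\<rceil> + 1) = (if nat \<bar>(m - n) $ i\<bar> = h then h + 1 else h)" for i
    unfolding ends(1,2) using ends(4) [of i] by auto
  then show "1 / real (card (cube x r)) = weight (m - n)"
    unfolding card_cube weight_def h_def by (simp add: prod_dividef)
qed

subsection \<open>The maximal function\<close>

lemma cube_average_nonneg: "0 \<le> cube_average f x r"
  by (simp add: cube_average_def sum_nonneg)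

lemma sum_le_ell1_norm:
  assumes "f \<in> ell1" "finite A"
  shows "(\<Sum>m\<in>A. \<bar>f m\<bar>) \<le> ell1_norm f"
  unfolding ell1_norm_def by (rule finite_sum_le_infsum) (use assms in \<open>auto simp: ell1_def\<close>)

lemma ell1_norm_nonneg: "0 \<le> ell1_norm f"
  unfolding ell1_norm_def by (rule infsum_nonneg) simp

lemma cube_average_le_ell1_norm:
  assumes "f \<in> ell1"
  shows "cube_average f x r \<le> ell1_norm f / real (card (cube x r))"
  unfolding cube_average_def by (intro divide_right_mono sum_le_ell1_norm assms finite_cube) simp

lemma bdd_above_cube_averages:
  assumes "f \<in> ell1"
  shows "bdd_above ((\<lambda>(x, r). cube_average f x r) ` {(x, r). r \<ge> 0 \<and> n \<in> cube x r})"
proof (rule bdd_aboveI2)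
  fix z :: "(real ^ 'a) \<times> real" assume "z \<in> {(x, r). r \<ge> 0 \<and> n \<in> cube x r}"
  then obtain x r where z: "z = (x, r)" "n \<in> cube x r" by auto
  have "ell1_norm f / real (card (cube x r)) \<le> ell1_norm f / 1"
    using card_cube_pos [OF z(2)] ell1_norm_nonneg by (intro divide_left_mono) auto
  then show "(case z of (x, r) \<Rightarrow> cube_average f x r) \<le> ell1_norm f"
    using cube_average_le_ell1_norm [OF assms, of x r] by (simp add: z)
qed

lemma cube_average_le_uncentered_maximal:
  assumes "f \<in> ell1" "0 \<le> r" "n \<in> cube x r"
  shows "cube_average f x r \<le> uncentered_maximal f n"
proof -
  have "(\<lambda>(x, r). cube_average f x r) (x, r) \<le> uncentered_maximal f n"
    unfolding uncentered_maximal_def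
    by (rule cSUP_upper [OF _ bdd_above_cube_averages]) (use assms in auto)
  then show ?thesis by simp
qed

lemma mem_cube_self: "n \<in> cube (lattice_embed n) 0"
  by (simp add: mem_cube_iff lattice_embed_def)

lemma admissible_cubes_nonempty: "{(x, r). r \<ge> 0 \<and> n \<in> cube x r} \<noteq> {}"
proof -
  have "(lattice_embed n, 0) \<in> {(x, r). r \<ge> 0 \<and> n \<in> cube x r}"
    by (simp add: mem_cube_self)
  then show ?thesis by blast
qed

lemma uncentered_maximal_nonneg:
  assumes "f \<in> ell1"
  shows "0 \<le> uncentered_maximal f n"
  using cube_average_le_uncentered_maximal [OF assms order_refl mem_cube_self]
    cube_average_nonneg order_trans by blast

lemma weight_le_uncentered_maximal:
  assumes "f \<in> ell1"
  shows "\<bar>f p\<bar> * weight (p - n) \<le> uncentered_maximal f n"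
proof -
  obtain x r where xr: "0 \<le> r" "p \<in> cube x r" "n \<in> cube x r"
    "1 / real (card (cube x r)) = weight (p - n)"
    using weight_attained .
  have "\<bar>f p\<bar> / real (card (cube x r)) \<le> cube_average f x r"
    unfolding cube_average_def using xr(2)
    by (intro divide_right_mono member_le_sum) (auto simp: finite_cube)
  also have "\<dots> \<le> uncentered_maximal f n"
    using assms xr by (intro cube_average_le_uncentered_maximal)
  finally show ?thesis by (simp flip: xr(4))
qed

text \<open>An average above half the supremum forces the cube to have few points, hence to lie in a
  fixed box around \<open>n\<close>. The average depends only on the set of lattice points, so the
  infinitely many competing centers and radii yield finitely many such values.\<close>

lemma uncentered_maximal_attained:
  fixes f :: "int ^ 'd \<Rightarrow> real"
  assumes "f \<in> ell1"
  obtains x r where "0 \<le> r" "n \<in> cube x r" "uncentered_maximal f n = cube_average f x r"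
proof (cases "uncentered_maximal f n > 0")
  case False
  \<comment> \<open>A supremum of zero is attained by the degenerate cube of radius 0.\<close>
  show thesis
  proof
    show "uncentered_maximal f n = cube_average f (lattice_embed n) 0"
      using False cube_average_le_uncentered_maximal [OF assms order_refl mem_cube_self, of n]
        cube_average_nonneg [of f "lattice_embed n" 0] by linarith
  qed (auto simp: mem_cube_self)
next
  case True
  define s where "s = uncentered_maximal f n"
  define K where "K = \<lceil>2 * ell1_norm f / s\<rceil>"
  define B where "B = {m :: int ^ 'd. \<forall>i. m $ i \<in> {n $ i - K..n $ i + K}}"
  define P where "P = {(x, r). r \<ge> 0 \<and> n \<in> cube x r \<and> s / 2 < cube_average f x r}"
  have "finite B"
    unfolding B_def cart_box_eq_image by (intro finite_imageI finite_PiE) auto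
  have "cube x r \<subseteq> B" if "(x, r) \<in> P" for x r
  proof
    fix m assume m: "m \<in> cube x r"
    have "s / 2 < cube_average f x r" "n \<in> cube x r"
      using that by (simp_all add: P_def)
    then have "s / 2 < ell1_norm f / real (card (cube x r))"
      using cube_average_le_ell1_norm [OF assms, of x r] by linarith
    then have "real (card (cube x r)) < 2 * ell1_norm f / s"
      using True card_cube_pos [OF \<open>n \<in> cube x r\<close>] by (simp add: s_def field_simps)
    then have "int (card (cube x r)) \<le> K" unfolding K_def by linarith
    then show "m \<in> B"
      using abs_diff_less_card_cube [OF m \<open>n \<in> cube x r\<close>] unfolding B_def
      by (auto simp: le_diff_eq) (smt (verit))+
  qed
  then have "(\<lambda>(x, r). cube x r) ` P \<subseteq> Pow B" by auto
  with \<open>finite B\<close> have "finite ((\<lambda>(x, r). cube x r) ` P)"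
    by (meson finite_Pow_iff finite_subset)
  then have "finite ((\<lambda>Q. (\<Sum>m\<in>Q. \<bar>f m\<bar>) / real (card Q)) ` (\<lambda>(x, r). cube x r) ` P)"
    by (rule finite_imageI)
  also have "(\<lambda>Q. (\<Sum>m\<in>Q. \<bar>f m\<bar>) / real (card Q)) ` (\<lambda>(x, r). cube x r) ` P
      = (\<lambda>(x, r). cube_average f x r) ` P" (is "_ = ?A")
    by (auto simp: image_image cube_average_def intro!: image_cong)
  finally have fin: "finite ?A" .
  have "s / 2 < uncentered_maximal f n" using True by (simp add: s_def)
  then obtain z where "z \<in> {(x, r). r \<ge> 0 \<and> n \<in> cube x r}" "s / 2 < (\<lambda>(x, r). cube_average f x r) z"
    unfolding uncentered_maximal_def
    by (subst (asm) less_cSUP_iff [OF admissible_cubes_nonempty bdd_above_cube_averages [OF assms]])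
      auto
  then have "z \<in> P" by (auto simp: P_def)
  then have "?A \<noteq> {}" by blast
  then obtain x r where xr: "(x, r) \<in> P" "Max ?A = cube_average f x r"
    using Max_in [OF fin] by auto
  have "uncentered_maximal f n \<le> cube_average f x r"
    unfolding uncentered_maximal_def
  proof (rule cSUP_least)
    fix z :: "(real ^ 'd) \<times> real" assume z: "z \<in> {(x, r). r \<ge> 0 \<and> n \<in> cube x r}"
    show "(\<lambda>(x, r). cube_average f x r) z \<le> cube_average f x r"
    proof (cases "z \<in> P")
      case True
      then show ?thesis unfolding xr(2) [symmetric] by (intro Max_ge fin imageI)
    next
      case False
      then show ?thesis using z xr(1) by (auto simp: P_def)
    qed
  qed (rule admissible_cubes_nonempty)
  with xr(1) cube_average_le_uncentered_maximal [OF assms, of r n x] show thesis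
    by (intro that [of r x]) (auto simp: P_def)
qed

subsection \<open>The sharp constant as a sum of weights\<close>

text \<open>The \<open>k\<close>-th summand of the constant; \<open>sum_weight_shell\<close>
  identifies it as the total weight of the offsets of height \<open>k\<close> in a coordinate
  hyperplane.\<close>

definition shell_term :: "nat \<Rightarrow> nat \<Rightarrow> real" where
  "shell_term d k = 1 / real k * ((2 / (real k + 1) + (2 * real k - 1) / real k) ^ (d - 1)
     - ((2 * real k - 1) / real k) ^ (d - 1))"

text \<open>An elementary mean value estimate; it extracts the small increment \<open>a\<close> as a
  factor.\<close>

lemma power_add_diff_le:
  fixes a b :: real
  assumes "0 \<le> a" "0 \<le> b"
  shows "(a + b) ^ n - b ^ n \<le> real n * a * (a + b) ^ (n - 1)"
proof (induction n)
  case (Suc n)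
  have "(a + b) ^ Suc n - b ^ Suc n = a * (a + b) ^ n + b * ((a + b) ^ n - b ^ n)"
    by (simp add: algebra_simps)
  also have "b * ((a + b) ^ n - b ^ n) \<le> (a + b) * ((a + b) ^ n - b ^ n)"
    using assms by (intro mult_right_mono) (auto intro!: power_mono)
  also have "\<dots> \<le> (a + b) * (real n * a * (a + b) ^ (n - 1))"
    using assms Suc by (intro mult_left_mono) auto
  also have "\<dots> = real n * a * (a + b) ^ n"
    by (cases n) auto
  finally show ?case by (simp add: algebra_simps)
qed simp

lemma shell_term_nonneg: "1 \<le> k \<Longrightarrow> 0 \<le> shell_term d k"
  unfolding shell_term_def by (intro mult_nonneg_nonneg) (auto intro!: power_mono)

text \<open>The increment is at most 2/k and the base at most 3, so the difference of powers is
  O(1/k); the prefactor supplies the second 1/k.\<close>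

lemma shell_term_le:
  assumes "1 \<le> k"
  shows "shell_term d k \<le> 2 * real (d - 1) * 3 ^ (d - 1 - 1) * (1 / real k ^ 2)"
proof -
  define a b where "a = 2 / (real k + 1)" and "b = (2 * real k - 1) / real k"
  have k: "1 \<le> real k" using assms by simp
  have a: "0 \<le> a" "a \<le> 1" "a \<le> 2 / real k"
    using k by (auto simp: a_def field_simps)
  have b: "0 \<le> b" "b \<le> 2"
    using k by (auto simp: b_def field_simps)
  have "(a + b) ^ (d - 1) - b ^ (d - 1) \<le> real (d - 1) * a * (a + b) ^ (d - 1 - 1)"
    by (intro power_add_diff_le a b)
  also have "\<dots> \<le> real (d - 1) * (2 / real k) * 3 ^ (d - 1 - 1)"
    using a b by (intro mult_mono power_mono) auto
  finally have "1 / real k * ((a + b) ^ (d - 1) - b ^ (d - 1))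
      \<le> 1 / real k * (real (d - 1) * (2 / real k) * 3 ^ (d - 1 - 1))"
    by (intro mult_left_mono) auto
  then show ?thesis
    by (simp add: shell_term_def a_def b_def power2_eq_square mult_ac)
qed

text \<open>Keeps the constant meaningful, since \<open>infsum\<close> of a divergent family would
  be 0.\<close>

lemma summable_shell_term: "shell_term d summable_on {1..}"
proof (rule summable_on_comparison_test)
  have "summable (\<lambda>k. inverse (real k ^ 2))"
    by (rule inverse_power_summable) simp
  then have "(\<lambda>k. inverse (real k ^ 2)) summable_on UNIV"
    by (intro norm_summable_imp_summable_on) (simp add: norm_inverse norm_power)
  then have "(\<lambda>k. 1 / real k ^ 2) summable_on {1..}"
    unfolding inverse_eq_divide by (rule summable_on_subset) simp
  then show "(\<lambda>k. 2 * real (d - 1) * 3 ^ (d - 1 - 1) * (1 / real k ^ 2)) summable_on {1..}"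
    by (rule summable_on_cmult_right)
qed (use shell_term_le shell_term_nonneg in auto)

lemma sharp_const_eq: "sharp_const d = 2 * real d * (1 + (\<Sum>\<^sub>\<infinity>k\<in>{1..}. shell_term d k))"
  by (simp add: sharp_const_def shell_term_def)

lemma infsum_shell_term_nonneg: "0 \<le> (\<Sum>\<^sub>\<infinity>k\<in>{1..}. shell_term d k)"
  by (rule infsum_nonneg) (auto intro: shell_term_nonneg)

lemma sharp_const_pos: "0 < d \<Longrightarrow> 0 < sharp_const d"
  using infsum_shell_term_nonneg [of d] by (simp add: sharp_const_eq add_pos_nonneg)

lemma height_le_iff_box: "height y \<le> j \<longleftrightarrow> (\<forall>l. y $ l \<in> {- int j..int j})"
proof -
  have "nat \<bar>t\<bar> \<le> j \<longleftrightarrow> t \<in> {- int j..int j}" for t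
    by auto
  then show ?thesis by (simp only: height_le_iff)
qed

text \<open>Both conditions restrict the coordinates separately, so the sum factors. Coordinate
  \<open>i\<close> is pinned to 0 and the other coordinates give equal factors.\<close>

lemma sum_section:
  fixes u :: "int \<Rightarrow> real" and i :: "'d::finite"
  shows "(\<Sum>y\<in>{y :: int ^ 'd. y $ i = 0 \<and> height y \<le> j}. \<Prod>l\<in>UNIV. u (y $ l))
    = u 0 * (\<Sum>t\<in>{- int j..int j}. u t) ^ (CARD('d) - 1)"
proof -
  define S where "S l = (if l = i then {0} else {- int j..int j})" for l
  have fin: "finite (S l)" for l by (simp add: S_def)
  have "{y :: int ^ 'd. y $ i = 0 \<and> height y \<le> j} = {y. \<forall>l. y $ l \<in> S l}"
  proof (intro Collect_cong iffI allI conjI)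
    fix y :: "int ^ 'd" and l
    assume "y $ i = 0 \<and> height y \<le> j"
    then show "y $ l \<in> S l" by (simp add: S_def height_le_iff_box)
  next
    fix y :: "int ^ 'd"
    assume y: "\<forall>l. y $ l \<in> S l"
    then show y_i: "y $ i = 0" by (metis S_def singletonD)
    have "y $ l \<in> {- int j..int j}" for l
      using y [rule_format, of l] y_i by (cases "l = i") (simp_all add: S_def)
    then show "height y \<le> j" unfolding height_le_iff_box by blast
  qed
  then have "(\<Sum>y\<in>{y :: int ^ 'd. y $ i = 0 \<and> height y \<le> j}. \<Prod>l\<in>UNIV. u (y $ l))
      = (\<Prod>l\<in>UNIV. \<Sum>t\<in>S l. u t)"
    using sum_prod_cart_box [of S "\<lambda>_. u", OF fin] by (simp only:)
  also have "\<dots> = (\<Sum>t\<in>S i. u t) * (\<Prod>l\<in>UNIV - {i}. \<Sum>t\<in>S l. u t)"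
    by (rule prod.remove) auto
  also have "(\<Prod>l\<in>UNIV - {i}. \<Sum>t\<in>S l. u t) = (\<Prod>l\<in>UNIV - {i}. \<Sum>t\<in>{- int j..int j}. u t)"
    by (rule prod.cong) (auto simp: S_def)
  finally show ?thesis by (simp add: S_def card_Diff_singleton)
qed

lemma finite_section: "finite {y :: int ^ 'd. y $ i = 0 \<and> height y \<le> j}"
proof (rule finite_subset)
  show "{y :: int ^ 'd. y $ i = 0 \<and> height y \<le> j} \<subseteq> {y. \<forall>l. y $ l \<in> {- int j..int j}}"
    unfolding height_le_iff_box by blast
  show "finite {y :: int ^ 'd. \<forall>l. y $ l \<in> {- int j..int j}}"
    unfolding cart_box_eq_image by (intro finite_imageI finite_PiE) auto
qed

lemma sum_weight_shell:
  fixes i :: "'d::finite"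
  assumes "1 \<le> k"
  shows "(\<Sum>y\<in>{y :: int ^ 'd. y $ i = 0 \<and> height y = k}. weight y) = shell_term CARD('d) k"
proof -
  \<comment> \<open>Here \<open>k\<close> is fixed, so the product of the \<open>u (y $ l)\<close>
    agrees with \<open>weight\<close> on the shell of height \<open>k\<close> only. The values on
    the smaller box cancel in the difference of the two boxes.\<close>
  define u where "u t = 1 / real (if nat \<bar>t\<bar> = k then k + 1 else k)" for t
  define box where "box j = {y :: int ^ 'd. y $ i = 0 \<and> height y \<le> j}" for j
  have inner: "(\<Sum>t\<in>{- int (k - 1)..int (k - 1)}. u t) = (2 * real k - 1) / real k"
  proof -
    have "(\<Sum>t\<in>{- int (k - 1)..int (k - 1)}. u t) = (\<Sum>t\<in>{- int (k - 1)..int (k - 1)}. 1 / real k)"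
      proof (rule sum.cong [OF refl])
      fix t assume "t \<in> {- int (k - 1)..int (k - 1)}"
      then have "- int (k - 1) \<le> t" "t \<le> int (k - 1)" by auto
      then have "\<bar>t\<bar> < int k" using assms by linarith
      then have "nat \<bar>t\<bar> \<noteq> k" by linarith
      then show "u t = 1 / real k" by (simp add: u_def)
    qed
    then show ?thesis using assms by (simp add: of_nat_diff)
  qed
  \<comment> \<open>The two ends contribute 1/(k+1) each, the 2k-1 integers between them 1/k
    each.\<close>
  have "{- int k..int k} = insert (int k) (insert (- int k) {- int (k - 1)..int (k - 1)})"
    using assms by auto
  then have outer: "(\<Sum>t\<in>{- int k..int k}. u t) = 2 / (real k + 1) + (2 * real k - 1) / real k"
    using assms inner by (simp add: u_def)
  have "{y :: int ^ 'd. y $ i = 0 \<and> height y = k} = box k - box (k - 1)"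
    using assms by (auto simp: box_def)
  then have "(\<Sum>y\<in>{y :: int ^ 'd. y $ i = 0 \<and> height y = k}. weight y)
      = (\<Sum>y\<in>box k - box (k - 1). \<Prod>l\<in>UNIV. u (y $ l))"
    by (intro sum.cong) (auto simp: weight_def u_def)
  also have "\<dots> = (\<Sum>y\<in>box k. \<Prod>l\<in>UNIV. u (y $ l)) - (\<Sum>y\<in>box (k - 1). \<Prod>l\<in>UNIV. u (y $ l))"
    by (rule sum_diff) (auto simp: box_def finite_section)
  also have "\<dots> = shell_term CARD('d) k"
    unfolding box_def sum_section inner outer
    using assms by (simp add: u_def shell_term_def right_diff_distrib)
  finally show ?thesis .
qed

text \<open>The hyperplane is split into shells by height. The shell of height 0 is the origin alone
  and gives the summand 1.\<close>

lemma infsum_weight: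
  fixes i :: "'d::finite"
  shows "(\<Sum>\<^sub>\<infinity>y\<in>{y :: int ^ 'd. y $ i = 0}. ennreal (weight y))
    = ennreal (1 + (\<Sum>\<^sub>\<infinity>k\<in>{1..}. shell_term CARD('d) k))"
proof -
  define shell where "shell k = {y :: int ^ 'd. y $ i = 0 \<and> height y = k}" for k
  have finite_shell: "finite (shell k)" for k
    by (rule finite_subset [OF _ finite_section [of i k]]) (auto simp: shell_def)
  have "height y = 0 \<longleftrightarrow> y = 0" for y :: "int ^ 'd"
  proof -
    have "height y = 0 \<longleftrightarrow> height y \<le> 0" by simp
    also have "\<dots> \<longleftrightarrow> (\<forall>l. y $ l = 0)" unfolding height_le_iff_box by simp
    finally show ?thesis by (simp add: vec_eq_iff)
  qed
  then have shell_0: "shell 0 = {0}" unfolding shell_def by force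
  have "(\<Sum>\<^sub>\<infinity>y\<in>{y :: int ^ 'd. y $ i = 0}. ennreal (weight y))
      = (\<Sum>\<^sub>\<infinity>(k, y)\<in>Sigma UNIV shell. ennreal (weight y))"
    by (rule infsum_reindex_bij_witness [of _ snd "\<lambda>y. (height y, y)"]) (auto simp: shell_def)
  also have "\<dots> = (\<Sum>\<^sub>\<infinity>k. ennreal (\<Sum>y\<in>shell k. weight y))"
    by (simp add: infsum_Sigma_ennreal finite_shell sum_ennreal less_imp_le weight_pos)
  also have "\<dots> = (\<Sum>\<^sub>\<infinity>k\<in>insert 0 {1..}. ennreal (\<Sum>y\<in>shell k. weight y))"
    by (rule infsum_cong_neutral) auto
  also have "\<dots> = 1 + (\<Sum>\<^sub>\<infinity>k\<in>{1..}. ennreal (\<Sum>y\<in>shell k. weight y))"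
    by (subst infsum_insert) (auto simp: shell_0 weight_0 intro: nonneg_summable_on_complete)
  also have "(\<Sum>\<^sub>\<infinity>k\<in>{1..}. ennreal (\<Sum>y\<in>shell k. weight y)) = (\<Sum>\<^sub>\<infinity>k\<in>{1..}. ennreal (shell_term CARD('d) k))"
    by (rule infsum_cong) (simp add: shell_def sum_weight_shell)
  also have "\<dots> = ennreal (\<Sum>\<^sub>\<infinity>k\<in>{1..}. shell_term CARD('d) k)"
    by (rule ennreal_infsum [OF summable_shell_term]) (auto intro: shell_term_nonneg)
  also have "1 + ennreal (\<Sum>\<^sub>\<infinity>k\<in>{1..}. shell_term CARD('d) k)
      = ennreal (1 + (\<Sum>\<^sub>\<infinity>k\<in>{1..}. shell_term CARD('d) k))"
    by (subst ennreal_plus) (simp_all add: infsum_shell_term_nonneg del: One_nat_def)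
  finally show ?thesis .
qed

subsection \<open>Variation of the maximal function on a line\<close>

text \<open>Each lattice point is \<open>y + axis i t\<close> for a unique \<open>t\<close> and a
  unique \<open>y\<close> with \<open>y $ i = 0\<close>, so direction \<open>i\<close> splits into
  parallel lines.\<close>

lemma total_variation_lines:
  fixes F :: "int ^ 'd \<Rightarrow> real"
  shows "total_variation F = (\<Sum>i\<in>UNIV. \<Sum>\<^sub>\<infinity>y\<in>{y. y $ i = 0}. \<Sum>\<^sub>\<infinity>t.
    ennreal \<bar>F (y + axis i (t + 1)) - F (y + axis i t)\<bar>)"
  unfolding total_variation_def
proof (rule sum.cong [OF refl])
  fix i :: 'd
  have axis_add: "axis i (t + 1) = axis i t + axis i (1 :: int)" for t
    by (simp add: vec_eq_iff axis_def)
  have axis_same: "axis i t $ i = t" for t :: int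
    by (simp add: axis_def)
  have "(\<Sum>\<^sub>\<infinity>n. ennreal \<bar>F (n + axis i 1) - F n\<bar>)
      = (\<Sum>\<^sub>\<infinity>(y, t)\<in>{y. y $ i = 0} \<times> UNIV. ennreal \<bar>F (y + axis i (t + 1)) - F (y + axis i t)\<bar>)"
    by (rule infsum_reindex_bij_witness
        [of _ "\<lambda>(y, t). y + axis i t" "\<lambda>n. (n - axis i (n $ i), n $ i)"])
      (auto simp: axis_add axis_same algebra_simps)
  then show "(\<Sum>\<^sub>\<infinity>n. ennreal \<bar>F (n + axis i 1) - F n\<bar>)
      = (\<Sum>\<^sub>\<infinity>y\<in>{y. y $ i = 0}. \<Sum>\<^sub>\<infinity>t. ennreal \<bar>F (y + axis i (t + 1)) - F (y + axis i t)\<bar>)"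
    by (simp add: infsum_Sigma_ennreal)
qed

text \<open>Double counting: by disjointness a point \<open>m\<close> carries at most one charge
  \<open>c t\<close>, and this is at most \<open>w m\<close>. The second claim keeps the slack at a
  chosen point \<open>n\<close>, as needed for strict inequality.\<close>

lemma sum_over_disjoint_le:
  fixes f w :: "'a \<Rightarrow> real"
  assumes "finite T" and fin: "\<And>t. t \<in> T \<Longrightarrow> finite (Q t)"
    and disj: "\<And>s t. s \<in> T \<Longrightarrow> t \<in> T \<Longrightarrow> s \<noteq> t \<Longrightarrow> Q s \<inter> Q t = {}"
    and c: "\<And>t m. t \<in> T \<Longrightarrow> m \<in> Q t \<Longrightarrow> c t \<le> w m"
    and w: "\<And>m. 0 \<le> w m" and f: "\<And>m. 0 \<le> f m"
    and summable: "(\<lambda>m. f m * w m) summable_on UNIV"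
  shows "(\<Sum>t\<in>T. c t * (\<Sum>m\<in>Q t. f m)) \<le> (\<Sum>\<^sub>\<infinity>m. f m * w m)" (is ?le)
    and "(\<Sum>t\<in>T. c t * (\<Sum>m\<in>Q t. f m)) + f n * (w n - (\<Sum>t\<in>{t\<in>T. n \<in> Q t}. c t))
      \<le> (\<Sum>\<^sub>\<infinity>m. f m * w m)" (is ?gap)
proof -
  define W where "W = insert n (\<Union>t\<in>T. Q t)"
  define \<theta> where "\<theta> m = (\<Sum>t\<in>{t\<in>T. m \<in> Q t}. c t)" for m
  have finW: "finite W" using assms(1,2) by (simp add: W_def)
  have \<theta>: "\<theta> m \<le> w m" for m
  proof (cases "\<exists>t\<in>T. m \<in> Q t")
    case True
    then obtain t where t: "t \<in> T" "m \<in> Q t" by blast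
    then have "{t\<in>T. m \<in> Q t} = {t}" using disj by blast
    then show ?thesis using c [OF t] by (simp add: \<theta>_def)
  next
    case False
    then have "{t\<in>T. m \<in> Q t} = {}" by blast
    then show ?thesis using w [of m] by (simp only: \<theta>_def sum.empty)
  qed
  have "(\<Sum>t\<in>T. c t * (\<Sum>m\<in>Q t. f m)) = (\<Sum>t\<in>T. \<Sum>m\<in>{m\<in>W. m \<in> Q t}. f m * c t)"
    by (intro sum.cong refl) (auto simp: sum_distrib_left mult.commute W_def intro!: sum.cong)
  also have "\<dots> = (\<Sum>m\<in>W. \<Sum>t\<in>{t\<in>T. m \<in> Q t}. f m * c t)"
    using assms(1) finW by (intro sum.swap_restrict)
  also have "\<dots> = (\<Sum>m\<in>W. f m * \<theta> m)"
    by (simp add: \<theta>_def sum_distrib_left)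
  finally have eq: "(\<Sum>t\<in>T. c t * (\<Sum>m\<in>Q t. f m)) = (\<Sum>m\<in>W. f m * \<theta> m)" .
  \<comment> \<open>All slacks are nonnegative, so the one at \<open>n\<close> is at most their
    sum.\<close>
  have "f n * (w n - \<theta> n) \<le> (\<Sum>m\<in>W. f m * (w m - \<theta> m))"
    using finW f \<theta> by (intro member_le_sum) (auto simp: W_def)
  also have "\<dots> = (\<Sum>m\<in>W. f m * w m) - (\<Sum>m\<in>W. f m * \<theta> m)"
    by (simp add: right_diff_distrib sum_subtractf)
  also have "(\<Sum>m\<in>W. f m * w m) \<le> (\<Sum>\<^sub>\<infinity>m. f m * w m)"
    using finW f w summable by (intro finite_sum_le_infsum) auto
  finally show gap: ?gap by (simp add: eq \<theta>_def)
  have "0 \<le> f n * (w n - \<theta> n)" using f \<theta> by simp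
  with gap show ?le by (simp add: \<theta>_def)
qed

section \<open>Maximizing cubes along one line\<close>

lemma mem_cube_line:
  fixes y :: "int ^ 'd"
  assumes "y $ i = 0" "y + axis i t \<in> cube x r"
  shows "y + axis i s \<in> cube x r \<longleftrightarrow> \<lceil>x $ i - r\<rceil> \<le> s \<and> s \<le> \<lfloor>x $ i + r\<rfloor>"
proof
  assume "y + axis i s \<in> cube x r"
  then show "\<lceil>x $ i - r\<rceil> \<le> s \<and> s \<le> \<lfloor>x $ i + r\<rfloor>"
    unfolding cube_eq_box using assms(1) by (auto dest!: spec [of _ i])
next
  assume s: "\<lceil>x $ i - r\<rceil> \<le> s \<and> s \<le> \<lfloor>x $ i + r\<rfloor>"
  show "y + axis i s \<in> cube x r"
    unfolding cube_eq_box
  proof (intro CollectI allI)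
    fix j
    show "(y + axis i s) $ j \<in> {\<lceil>x $ j - r\<rceil>..\<lfloor>x $ j + r\<rfloor>}"
      using s assms unfolding cube_eq_box
      by (cases "j = i") (auto simp: axis_def dest!: spec [of _ j])
  qed
qed

text \<open>Each \<open>m\<close> is compared with the point of the line that shares its coordinate
  \<open>i\<close>, where its point mass peaks on that line.\<close>

definition line_weight :: "(int ^ 'd \<Rightarrow> real) \<Rightarrow> 'd \<Rightarrow> int ^ 'd \<Rightarrow> real" where
  "line_weight f i y = (\<Sum>\<^sub>\<infinity>m. \<bar>f m\<bar> * weight (m - axis i (m $ i) - y))"

lemma summable_line_weight:
  assumes "f \<in> ell1"
  shows "(\<lambda>m. \<bar>f m\<bar> * weight (m - axis i (m $ i) - y)) summable_on UNIV"
proof (rule summable_on_comparison_test)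
  show "(\<lambda>m. \<bar>f m\<bar>) summable_on UNIV" using assms by (simp add: ell1_def)
qed (auto intro!: mult_left_le weight_le_1 mult_nonneg_nonneg less_imp_le [OF weight_pos])

text \<open>\<open>Q t\<close> is a cube whose average is \<open>g t\<close>; it also competes at
  every other point of the line inside it, which gives the plateau property. The last two
  conclusions serve the strict inequality: a valley between points of different cubes, and the slack
  at any point \<open>n\<close>.\<close>

lemma line_cubes:
  fixes f :: "int ^ 'd \<Rightarrow> real" and y :: "int ^ 'd"
  assumes f: "f \<in> ell1" and y: "y $ i = 0" and "a \<le> b"
  defines "g \<equiv> \<lambda>t. uncentered_maximal f (y + axis i t)"
  defines "V \<equiv> \<Sum>t\<in>{a..<b}. \<bar>g (t + 1) - g t\<bar>"
  obtains T :: "int set" and Q :: "int \<Rightarrow> (int ^ 'd) set" where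
    "V \<le> 2 * (\<Sum>t\<in>T. g t)"
    "(\<Sum>t\<in>T. g t) \<le> line_weight f i y"
    "\<And>t. t \<in> T \<Longrightarrow> finite (Q t)"
    "\<And>s t. s \<in> T \<Longrightarrow> t \<in> T \<Longrightarrow> s \<noteq> t \<Longrightarrow> Q s \<inter> Q t = {}"
    "\<And>s t m n. s \<in> T \<Longrightarrow> t \<in> T \<Longrightarrow> s < t \<Longrightarrow> m \<in> Q s \<Longrightarrow> n \<in> Q t \<Longrightarrow>
      \<exists>v. m $ i \<le> v \<and> v \<le> n $ i \<and> V + 2 * g v \<le> 2 * (\<Sum>t\<in>T. g t)"
    "\<And>n. (\<Sum>t\<in>T. g t) + \<bar>f n\<bar> * (weight (n - axis i (n $ i) - y)
        - (\<Sum>t\<in>{t\<in>T. n \<in> Q t}. 1 / real (card (Q t)))) \<le> line_weight f i y"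
proof -
  have "\<exists>x r. 0 \<le> r \<and> y + axis i t \<in> cube x r \<and> g t = cube_average f x r" for t
    unfolding g_def using uncentered_maximal_attained [OF f] by metis
  then obtain X R where XR: "\<And>t. 0 \<le> R t" "\<And>t. y + axis i t \<in> cube (X t) (R t)"
    "\<And>t. g t = cube_average f (X t) (R t)" by metis
  define Q where "Q t = cube (X t) (R t)" for t
  define l where "l t = \<lceil>X t $ i - R t\<rceil>" for t
  define r where "r t = \<lfloor>X t $ i + R t\<rfloor>" for t
  have line: "y + axis i s \<in> Q t \<longleftrightarrow> l t \<le> s \<and> s \<le> r t" for s t
    unfolding Q_def l_def r_def by (rule mem_cube_line [OF y XR(2)])
  have nonneg: "0 \<le> g t" for t
    unfolding g_def by (rule uncentered_maximal_nonneg [OF f])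
  have around: "l t \<le> t \<and> t \<le> r t" for t
    using XR(2) by (simp flip: line Q_def)
  have plateau: "g t \<le> g s" if "l t \<le> s" "s \<le> r t" for s t
  proof -
    have "y + axis i s \<in> Q t" using that line by blast
    then have "cube_average f (X t) (R t) \<le> uncentered_maximal f (y + axis i s)"
      unfolding Q_def by (intro cube_average_le_uncentered_maximal f XR(1))
    then show ?thesis by (simp only: XR(3)[of t]) (simp add: g_def)
  qed
  \<comment> \<open>This holds for points off the line too, so separated intervals on the line force
    disjoint cubes.\<close>
  have coord: "l t \<le> m $ i \<and> m $ i \<le> r t" if "m \<in> Q t" for m t
    using that unfolding Q_def cube_eq_box l_def r_def by auto
  obtain T where T: "T \<subseteq> {a..b}" "V + g a + g b \<le> 2 * sum g T"
    "\<And>s t. s \<in> T \<Longrightarrow> t \<in> T \<Longrightarrow> s < t \<Longrightarrow> r s < l t"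
    "\<And>s t. s \<in> T \<Longrightarrow> t \<in> T \<Longrightarrow> s < t \<Longrightarrow>
      \<exists>v. r s \<le> v \<and> v \<le> l t \<and> V + g a + g b + 2 * g v \<le> 2 * sum g T"
    using disjoint_interval_selection [where g = g and l = l and r = r and a = a and b = b,
        OF nonneg around plateau \<open>a \<le> b\<close>]
    unfolding V_def by blast
  have finT: "finite T" using T(1) finite_subset by blast
  have disj: "Q s \<inter> Q t = {}" if "s \<in> T" "t \<in> T" "s \<noteq> t" for s t
  proof (cases "s < t")
    case True
    then show ?thesis using T(3) [OF that(1,2)] coord [of _ s] coord [of _ t] by fastforce
  next
    case False
    then have "t < s" using that by simp
    then show ?thesis using T(3) [OF that(2,1)] coord [of _ s] coord [of _ t] by fastforce
  qed
  have g_eq: "g t = 1 / real (card (Q t)) * (\<Sum>m\<in>Q t. \<bar>f m\<bar>)" for t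
    by (simp add: XR(3) cube_average_def Q_def)
  show thesis
  proof (rule that [of T Q])
    show "V \<le> 2 * sum g T" using T(2) nonneg [of a] nonneg [of b] by linarith
    show "finite (Q t)" for t by (simp add: Q_def finite_cube)
    show "Q s \<inter> Q t = {}" if "s \<in> T" "t \<in> T" "s \<noteq> t" for s t
      using disj that .
    show "\<exists>v. m $ i \<le> v \<and> v \<le> n $ i \<and> V + 2 * g v \<le> 2 * sum g T"
      if st: "s \<in> T" "t \<in> T" "s < t" and mn: "m \<in> Q s" "n \<in> Q t" for s t m n
    proof -
      obtain v where "r s \<le> v" "v \<le> l t" "V + g a + g b + 2 * g v \<le> 2 * sum g T"
        using T(4) [OF st] by blast
      then show ?thesis
        using coord [OF mn(1)] coord [OF mn(2)] nonneg [of a] nonneg [of b]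
        by (intro exI [of _ v]) auto
    qed
    \<comment> \<open>\<open>Q t\<close> contains both \<open>m\<close> and its projection to the
      line, so its cardinality is bounded below through \<open>weight\<close>.\<close>
    have gap_premise: "1 / real (card (Q t)) \<le> weight (m - axis i (m $ i) - y)"
      if "t \<in> T" and m: "m \<in> Q t" for t m
    proof -
      have "y + axis i (m $ i) \<in> Q t" unfolding line using coord [OF m] .
      then have "1 / real (card (Q t)) \<le> weight (m - (y + axis i (m $ i)))"
        using m unfolding Q_def by (intro inverse_card_cube_le_weight)
      then show ?thesis by (simp add: algebra_simps)
    qed
    show "sum g T \<le> line_weight f i y"
      unfolding line_weight_def g_eq
      by (rule sum_over_disjoint_le(1) [OF finT _ disj gap_premise])
        (auto simp: Q_def finite_cube less_imp_le weight_pos summable_line_weight f)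
    show "sum g T + \<bar>f n\<bar> * (weight (n - axis i (n $ i) - y)
        - (\<Sum>t\<in>{t\<in>T. n \<in> Q t}. 1 / real (card (Q t)))) \<le> line_weight f i y" for n
      unfolding line_weight_def g_eq
      by (rule sum_over_disjoint_le(2) [OF finT _ disj gap_premise])
        (auto simp: Q_def finite_cube less_imp_le weight_pos summable_line_weight f)
  qed
qed

lemma line_variation_le:
  fixes f :: "int ^ 'd \<Rightarrow> real" and y :: "int ^ 'd"
  assumes f: "f \<in> ell1" and y: "y $ i = 0" and "a \<le> b"
  defines "g \<equiv> \<lambda>t. uncentered_maximal f (y + axis i t)"
  shows "(\<Sum>t\<in>{a..<b}. \<bar>g (t + 1) - g t\<bar>) \<le> 2 * line_weight f i y"
  unfolding g_def by (rule line_cubes [OF f y \<open>a \<le> b\<close>]) linarith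

text \<open>The gain \<eta> does not depend on \<open>a\<close> and \<open>b\<close>, so it survives
  the passage to the whole line.\<close>

lemma line_variation_less:
  fixes f :: "int ^ 'd \<Rightarrow> real" and p :: "int ^ 'd" and i :: 'd
  assumes f: "f \<in> ell1" and pq: "f p \<noteq> 0" "f q \<noteq> 0" "p \<noteq> q"
  defines "y \<equiv> p - axis i (p $ i)"
  defines "g \<equiv> \<lambda>t. uncentered_maximal f (y + axis i t)"
  obtains \<eta> where "\<eta> > 0"
    "\<And>a b. a \<le> b \<Longrightarrow> (\<Sum>t\<in>{a..<b}. \<bar>g (t + 1) - g t\<bar>) + \<eta> \<le> 2 * line_weight f i y"
proof -
  define w where "w m = weight (m - axis i (m $ i) - y)" for m
  define I where "I = {min (p $ i) (q $ i)..max (p $ i) (q $ i)}"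
  define \<kappa> where "\<kappa> = Min (g ` I)"
  \<comment> \<open>The first entry covers both a missed \<open>p\<close> and a cube shared by
    \<open>p\<close> and \<open>q\<close>, the second a missed \<open>q\<close>, the third a valley
    between different cubes.\<close>
  define \<eta> where "\<eta> = min (\<bar>f p\<bar>) (min (2 * \<bar>f q\<bar> * w q) (2 * \<kappa>))"
  have y: "y $ i = 0" by (simp add: y_def axis_def)
  have w: "w p = 1" "0 < w q" by (simp_all add: w_def y_def weight_0 weight_pos)
  \<comment> \<open>A single nonzero value of \<open>f\<close> makes the maximal function positive
    everywhere, in particular at any valley.\<close>
  have "0 < g t" for t
  proof -
    have "0 < \<bar>f p\<bar> * weight (p - (y + axis i t))" using pq by (simp add: weight_pos)
    also have "\<dots> \<le> g t" unfolding g_def by (rule weight_le_uncentered_maximal [OF f])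
    finally show ?thesis .
  qed
  then have "0 < \<kappa>" unfolding \<kappa>_def by (subst Min_gr_iff) (auto simp: I_def)
  then have "0 < \<eta>" using pq w by (simp add: \<eta>_def)
  have \<kappa>: "\<kappa> \<le> g v" if "v \<in> I" for v
    unfolding \<kappa>_def by (rule Min_le) (use that in \<open>auto simp: I_def\<close>)
  show thesis
  proof (rule that [OF \<open>0 < \<eta>\<close>])
    fix a b :: int
    assume "a \<le> b"
    let ?V = "\<Sum>t\<in>{a..<b}. \<bar>g (t + 1) - g t\<bar>"
    obtain T Q where T: "?V \<le> 2 * (\<Sum>t\<in>T. g t)"
      "(\<Sum>t\<in>T. g t) \<le> line_weight f i y"
      "\<And>t. t \<in> T \<Longrightarrow> finite (Q t)"
      "\<And>s t. s \<in> T \<Longrightarrow> t \<in> T \<Longrightarrow> s \<noteq> t \<Longrightarrow> Q s \<inter> Q t = {}"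
      "\<And>s t m n. s \<in> T \<Longrightarrow> t \<in> T \<Longrightarrow> s < t \<Longrightarrow> m \<in> Q s \<Longrightarrow> n \<in> Q t \<Longrightarrow>
        \<exists>v. m $ i \<le> v \<and> v \<le> n $ i \<and> ?V + 2 * g v \<le> 2 * (\<Sum>t\<in>T. g t)"
      and gap: "\<And>n. (\<Sum>t\<in>T. g t) + \<bar>f n\<bar> * (w n
        - (\<Sum>t\<in>{t\<in>T. n \<in> Q t}. 1 / real (card (Q t)))) \<le> line_weight f i y"
      unfolding g_def w_def by (fact line_cubes [OF f y \<open>a \<le> b\<close>])
    have only: "{t\<in>T. m \<in> Q t} = {s}" if "s \<in> T" "m \<in> Q s" for m s
      using T(4) that by blast
    consider "{t\<in>T. p \<in> Q t} = {}" | "{t\<in>T. q \<in> Q t} = {}"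
      | s where "s \<in> T" "p \<in> Q s" "q \<in> Q s"
      | s t where "s \<in> T" "t \<in> T" "p \<in> Q s" "q \<in> Q t" "s \<noteq> t"
      by blast
    then show "?V + \<eta> \<le> 2 * line_weight f i y"
    proof cases
      case 1
      then have "sum g T + \<bar>f p\<bar> \<le> line_weight f i y"
        using gap [of p] by (simp only: w sum.empty) simp
      then show ?thesis using T(1) by (simp add: \<eta>_def)
    next
      case 2
      then have "sum g T + \<bar>f q\<bar> * w q \<le> line_weight f i y"
        using gap [of q] by (simp only: sum.empty) simp
      then show ?thesis using T(1) by (simp add: \<eta>_def)
    next
      case 3
      \<comment> \<open>With two points in the cube, \<open>p\<close> is charged at most half of its
        weight \<open>w p = 1\<close>.\<close>
      have "card {p, q} \<le> card (Q s)" using 3 T(3) by (intro card_mono) auto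
      then have "1 / real (card (Q s)) \<le> 1 / 2"
        using pq by (intro divide_left_mono) auto
      then have "\<bar>f p\<bar> * (1 / 2) \<le> \<bar>f p\<bar> * (1 - 1 / real (card (Q s)))"
        by (intro mult_left_mono) auto
      also have "sum g T + \<dots> \<le> line_weight f i y"
        using gap [of p] only [OF 3(1,2)] by (simp only: w) simp
      finally show ?thesis using T(1) by (simp add: \<eta>_def)
    next
      case 4
      have "\<exists>v\<in>I. ?V + 2 * g v \<le> 2 * sum g T"
      proof (cases "s < t")
        case True
        then show ?thesis using T(5) [OF 4(1,2) _ 4(3,4)] by (force simp: I_def)
      next
        case False
        then show ?thesis using 4(5) T(5) [OF 4(2,1) _ 4(4,3)] by (force simp: I_def)
      qed
      then obtain v where "v \<in> I" "?V + 2 * g v \<le> 2 * sum g T" by blast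
      then show ?thesis using \<kappa> [of v] T(2) by (simp add: \<eta>_def)
    qed
  qed
qed

section \<open>Summation over all lines\<close>

lemma line_weight_nonneg: "0 \<le> line_weight f i y"
  unfolding line_weight_def by (intro infsum_nonneg mult_nonneg_nonneg less_imp_le [OF weight_pos]) auto

lemma infsum_weight_translate:
  fixes i :: "'d::finite"
  assumes "z $ i = 0"
  shows "(\<Sum>\<^sub>\<infinity>y\<in>{y :: int ^ 'd. y $ i = 0}. ennreal (weight (z - y)))
    = ennreal (1 + (\<Sum>\<^sub>\<infinity>k\<in>{1..}. shell_term CARD('d) k))"
proof -
  have "(\<Sum>\<^sub>\<infinity>y\<in>{y :: int ^ 'd. y $ i = 0}. ennreal (weight (z - y)))
      = (\<Sum>\<^sub>\<infinity>y\<in>{y :: int ^ 'd. y $ i = 0}. ennreal (weight y))"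
    by (rule infsum_reindex_bij_witness [of _ "\<lambda>y. z - y" "\<lambda>y. z - y"]) (use assms in auto)
  then show ?thesis by (simp only: infsum_weight)
qed

text \<open>After exchanging the sums, each \<open>m\<close> is treated alone: the sum over
  \<open>y\<close> does not depend on where \<open>m\<close> projects, by translation.\<close>

lemma infsum_line_weight:
  fixes f :: "int ^ 'd \<Rightarrow> real"
  assumes f: "f \<in> ell1"
  shows "(\<Sum>\<^sub>\<infinity>y\<in>{y. y $ i = 0}. ennreal (2 * line_weight f i y))
    = ennreal (2 * ell1_norm f * (1 + (\<Sum>\<^sub>\<infinity>k\<in>{1..}. shell_term CARD('d) k)))"
    (is "?L = ennreal (_ * ?S)")
proof -
  have S: "0 \<le> ?S" using infsum_shell_term_nonneg [of "CARD('d)"] by linarith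
  have "ennreal (2 * line_weight f i y) = 2 * (\<Sum>\<^sub>\<infinity>m. ennreal \<bar>f m\<bar> * ennreal (weight (m - axis i (m $ i) - y)))" for y
  proof -
    have "ennreal (line_weight f i y) = (\<Sum>\<^sub>\<infinity>m. ennreal (\<bar>f m\<bar> * weight (m - axis i (m $ i) - y)))"
      unfolding line_weight_def
      by (rule ennreal_infsum [symmetric, OF summable_line_weight [OF f]])
        (intro mult_nonneg_nonneg less_imp_le [OF weight_pos], simp)
    then show ?thesis
      by (simp add: ennreal_mult less_imp_le [OF weight_pos] line_weight_nonneg)
  qed
  then have "?L = 2 * (\<Sum>\<^sub>\<infinity>y\<in>{y. y $ i = 0}. \<Sum>\<^sub>\<infinity>m.
      ennreal \<bar>f m\<bar> * ennreal (weight (m - axis i (m $ i) - y)))"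
    by (simp only: infsum_ennreal_cmult)
  also have "\<dots> = 2 * (\<Sum>\<^sub>\<infinity>m. ennreal \<bar>f m\<bar> *
      (\<Sum>\<^sub>\<infinity>y\<in>{y. y $ i = 0}. ennreal (weight (m - axis i (m $ i) - y))))"
    by (simp only: infsum_swap_ennreal [of _ UNIV] infsum_ennreal_cmult)
  also have "\<dots> = 2 * (\<Sum>\<^sub>\<infinity>m. ennreal ?S * ennreal \<bar>f m\<bar>)"
    by (subst infsum_weight_translate) (simp_all add: axis_def mult.commute)
  also have "\<dots> = 2 * (ennreal ?S * ennreal (ell1_norm f))"
    unfolding infsum_ennreal_cmult ell1_norm_def using f
    by (subst ennreal_infsum) (auto simp: ell1_def)
  also have "\<dots> = ennreal (2 * ell1_norm f * ?S)"
  proof -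
    have "2 * (ennreal s * ennreal c) = ennreal (2 * c * s)" if "0 \<le> s" "0 \<le> c" for s c
      using that by (simp add: ennreal_mult mult_ac)
    then show ?thesis using S ell1_norm_nonneg by blast
  qed
  finally show ?thesis .
qed

lemma sharp_const_sum:
  "(\<Sum>i\<in>(UNIV :: 'd::finite set). ennreal (2 * c * (1 + (\<Sum>\<^sub>\<infinity>k\<in>{1..}. shell_term CARD('d) k))))
    = ennreal (sharp_const CARD('d) * c)" if "0 \<le> c"
proof -
  have "0 \<le> 2 * c * (1 + (\<Sum>\<^sub>\<infinity>k\<in>{1..}. shell_term CARD('d) k))"
    using that infsum_shell_term_nonneg [of "CARD('d)"] by (intro mult_nonneg_nonneg) auto
  then have "(\<Sum>i\<in>(UNIV :: 'd set). ennreal (2 * c * (1 + (\<Sum>\<^sub>\<infinity>k\<in>{1..}. shell_term CARD('d) k))))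
    = ennreal (\<Sum>i\<in>(UNIV :: 'd set). 2 * c * (1 + (\<Sum>\<^sub>\<infinity>k\<in>{1..}. shell_term CARD('d) k)))"
    by (rule sum_ennreal)
  then show ?thesis by (simp add: sharp_const_eq mult_ac del: One_nat_def)
qed

lemma infsum_int_le:
  fixes h :: "int \<Rightarrow> real"
  assumes "\<And>t. 0 \<le> h t" "\<And>a b. a \<le> b \<Longrightarrow> (\<Sum>t\<in>{a..<b}. h t) \<le> c"
  shows "(\<Sum>\<^sub>\<infinity>t. ennreal (h t)) \<le> ennreal c"
  unfolding infsum_ennreal_SUP
proof (rule SUP_least, clarify)
  fix F :: "int set" assume "finite F"
  define N where "N = (\<Sum>t\<in>F. \<bar>t\<bar>)"
  have "\<bar>t\<bar> \<le> N" if "t \<in> F" for t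
    unfolding N_def by (rule member_le_sum [OF that]) (auto simp: \<open>finite F\<close>)
  then have sub: "F \<subseteq> {- N..<N + 1}" by fastforce
  have "0 \<le> N" by (simp add: N_def sum_nonneg)
  have "sum h F \<le> (\<Sum>t\<in>{- N..<N + 1}. h t)"
    using sub assms(1) by (intro sum_mono2) auto
  also have "\<dots> \<le> c" by (rule assms(2)) (use \<open>0 \<le> N\<close> in simp)
  finally show "(\<Sum>t\<in>F. ennreal (h t)) \<le> ennreal c"
    using assms(1) by (simp add: sum_ennreal ennreal_leI)
qed

section \<open>Lower bound for the variation on a line\<close>

lemma abs_diff_le_variation:
  fixes g :: "int \<Rightarrow> real"
  assumes "a \<le> b"
  shows "\<bar>g b - g a\<bar> \<le> (\<Sum>t\<in>{a..<b}. \<bar>g (t + 1) - g t\<bar>)"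
  using assms
proof (induction b rule: int_ge_induct)
  case (step b)
  have "{a..<b + 1} = insert b {a..<b}" using step.hyps by auto
  then show ?case using step.IH by simp
qed simp

text \<open>Climbing to \<open>c\<close> from the left and descending to the right costs at least
  \<open>2 * g c\<close> minus the two end values, which tend to 0 by the assumed decay.\<close>

lemma variation_ge_peak:
  fixes g :: "int \<Rightarrow> real"
  assumes "\<And>N :: nat. g (c - int N) + g (c + int N) \<le> D / real (N + 1)"
  shows "ennreal (2 * g c) \<le> (\<Sum>\<^sub>\<infinity>t. ennreal \<bar>g (t + 1) - g t\<bar>)"
proof (cases "\<Sum>\<^sub>\<infinity>t. ennreal \<bar>g (t + 1) - g t\<bar>")
  case (real v)
  have "2 * g c - D / real (N + 1) \<le> v" for N
  proof -
    let ?h = "\<lambda>t. \<bar>g (t + 1) - g t\<bar>"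
    have "{c - int N..<c + int N} = {c - int N..<c} \<union> {c..<c + int N}" by auto
    then have "sum ?h {c - int N..<c + int N} = sum ?h {c - int N..<c} + sum ?h {c..<c + int N}"
      by (simp only:) (rule sum.union_disjoint; auto)
    moreover have "\<bar>g c - g (c - int N)\<bar> \<le> sum ?h {c - int N..<c}"
      "\<bar>g (c + int N) - g c\<bar> \<le> sum ?h {c..<c + int N}"
      by (rule abs_diff_le_variation; simp)+
    ultimately have le: "2 * g c - D / real (N + 1) \<le> sum ?h {c - int N..<c + int N}"
      using assms [of N] by linarith
    have "ennreal (sum ?h {c - int N..<c + int N}) = (\<Sum>t\<in>{c - int N..<c + int N}. ennreal (?h t))"
      by (simp add: sum_ennreal)
    also have "\<dots> \<le> ennreal v"
      unfolding real(2) [symmetric] infsum_ennreal_SUP by (rule SUP_upper) simp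
    finally show ?thesis using le real(1) by (simp add: ennreal_le_iff)
  qed
  moreover have "(\<lambda>N. 2 * g c - D / real (N + 1)) \<longlonglongrightarrow> 2 * g c - 0"
    using lim_const_over_n [of D, THEN LIMSEQ_Suc] by (intro tendsto_diff tendsto_const) simp
  ultimately have "2 * g c - 0 \<le> v" by (intro LIMSEQ_le_const2) auto
  then show ?thesis by (simp add: real ennreal_leI)
qed simp

subsection \<open>Delta functions and the main estimate\<close>

lemma delta_function_ell1:
  assumes "\<forall>n. n \<noteq> p \<longrightarrow> f n = 0"
  shows "f \<in> ell1" "ell1_norm f = \<bar>f p\<bar>"
proof -
  have "(\<lambda>n. \<bar>f n\<bar>) summable_on UNIV \<longleftrightarrow> (\<lambda>n. \<bar>f n\<bar>) summable_on {p}"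
    by (rule summable_on_cong_neutral) (use assms in auto)
  then show "f \<in> ell1" by (simp add: ell1_def)
  have "(\<Sum>\<^sub>\<infinity>n. \<bar>f n\<bar>) = (\<Sum>\<^sub>\<infinity>n\<in>{p}. \<bar>f n\<bar>)"
    by (rule infsum_cong_neutral) (use assms in auto)
  then show "ell1_norm f = \<bar>f p\<bar>" by (simp add: ell1_norm_def)
qed

text \<open>A cube through \<open>n\<close> and \<open>p\<close> has at least as many points as its
  coordinate span requires, and a cube missing \<open>p\<close> has average 0. This is the decay
  that \<open>variation_ge_peak\<close> asks for.\<close>

lemma uncentered_maximal_delta_le:
  fixes f :: "int ^ 'd \<Rightarrow> real"
  assumes f: "\<forall>n. n \<noteq> p \<longrightarrow> f n = 0"
  shows "uncentered_maximal f n \<le> \<bar>f p\<bar> / real_of_int (\<bar>n $ i - p $ i\<bar> + 1)"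
proof -
  note ell1 = delta_function_ell1 [OF f]
  obtain x r where xr: "0 \<le> r" "n \<in> cube x r" "uncentered_maximal f n = cube_average f x r"
    using uncentered_maximal_attained [OF ell1(1)] .
  show ?thesis
  proof (cases "p \<in> cube x r")
    case True
    have "cube_average f x r \<le> \<bar>f p\<bar> / real (card (cube x r))"
      using cube_average_le_ell1_norm [OF ell1(1)] by (simp only: ell1(2))
    also have "\<dots> \<le> \<bar>f p\<bar> / real_of_int (\<bar>n $ i - p $ i\<bar> + 1)"
    proof (rule divide_left_mono)
      have "real_of_int (\<bar>n $ i - p $ i\<bar> + 1) \<le> real_of_int (int (card (cube x r)))"
        using abs_diff_less_card_cube [OF xr(2) True, of i] by (rule of_int_le_iff [THEN iffD2])
      then show "real_of_int (\<bar>n $ i - p $ i\<bar> + 1) \<le> real (card (cube x r))" by simp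
      show "0 < real (card (cube x r)) * real_of_int (\<bar>n $ i - p $ i\<bar> + 1)"
        using card_cube_pos [OF True] by (intro mult_pos_pos) (simp, linarith)
    qed simp
    finally show ?thesis by (simp only: xr(3))
  next
    case False
    then have "cube_average f x r = 0"
      unfolding cube_average_def by (subst sum.neutral) (use f in auto)
    then show ?thesis by (simp add: xr(3))
  qed
qed

text \<open>Only \<open>m = p\<close> contributes to \<open>line_weight\<close>, and its term is a
  lower bound for the maximal function at the point of the line level with \<open>p\<close>.\<close>

lemma total_variation_delta_ge:
  fixes f :: "int ^ 'd \<Rightarrow> real"
  assumes f: "\<forall>n. n \<noteq> p \<longrightarrow> f n = 0"
  shows "ennreal (sharp_const CARD('d) * ell1_norm f) \<le> total_variation (uncentered_maximal f)"
proof -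
  note ell1 = delta_function_ell1 [OF f]
  have peak: "ennreal (2 * line_weight f i y) \<le> (\<Sum>\<^sub>\<infinity>t.
      ennreal \<bar>uncentered_maximal f (y + axis i (t + 1)) - uncentered_maximal f (y + axis i t)\<bar>)"
    if y: "y $ i = 0" for i y
  proof -
    let ?g = "\<lambda>t. uncentered_maximal f (y + axis i t)"
    have "line_weight f i y = (\<Sum>\<^sub>\<infinity>m\<in>{p}. \<bar>f m\<bar> * weight (m - axis i (m $ i) - y))"
      unfolding line_weight_def by (rule infsum_cong_neutral) (use f in auto)
    also have "\<dots> = \<bar>f p\<bar> * weight (p - (y + axis i (p $ i)))" by (simp add: algebra_simps)
    also have "\<dots> \<le> ?g (p $ i)" by (rule weight_le_uncentered_maximal [OF ell1(1)])
    finally have "ennreal (2 * line_weight f i y) \<le> ennreal (2 * ?g (p $ i))"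
      by (intro ennreal_leI) simp
    also have "\<dots> \<le> (\<Sum>\<^sub>\<infinity>t. ennreal \<bar>?g (t + 1) - ?g t\<bar>)"
    proof (rule variation_ge_peak)
      fix N
      have bound: "?g t \<le> \<bar>f p\<bar> / real_of_int (\<bar>t - p $ i\<bar> + 1)" for t
        using uncentered_maximal_delta_le [OF f, of "y + axis i t" i] y by (simp add: axis_def)
      show "?g (p $ i - int N) + ?g (p $ i + int N) \<le> (2 * \<bar>f p\<bar>) / real (N + 1)"
        using add_mono [OF bound [of "p $ i - int N"] bound [of "p $ i + int N"]]
        by (simp flip: add_divide_distrib add: add.commute)
    qed
    finally show ?thesis .
  qed
  have "ennreal (sharp_const CARD('d) * ell1_norm f)
      = (\<Sum>i\<in>(UNIV :: 'd set). \<Sum>\<^sub>\<infinity>y\<in>{y. y $ i = 0}. ennreal (2 * line_weight f i y))"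
    by (simp only: infsum_line_weight [OF ell1(1)] sharp_const_sum [OF ell1_norm_nonneg])
  also have "\<dots> \<le> total_variation (uncentered_maximal f)"
    unfolding total_variation_lines
    by (intro sum_mono infsum_mono peak) (auto intro: nonneg_summable_on_complete)
  finally show ?thesis .
qed

lemma total_variation_le:
  fixes f :: "int ^ 'd \<Rightarrow> real"
  assumes f: "f \<in> ell1"
  shows "total_variation (uncentered_maximal f) \<le> ennreal (sharp_const CARD('d) * ell1_norm f)"
proof -
  have "total_variation (uncentered_maximal f)
      \<le> (\<Sum>i\<in>(UNIV :: 'd set). \<Sum>\<^sub>\<infinity>y\<in>{y. y $ i = 0}. ennreal (2 * line_weight f i y))"
    unfolding total_variation_lines
    by (intro sum_mono infsum_mono infsum_int_le line_variation_le f)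
      (auto intro: nonneg_summable_on_complete)
  also have "\<dots> = ennreal (sharp_const CARD('d) * ell1_norm f)"
    by (simp only: infsum_line_weight [OF f] sharp_const_sum [OF ell1_norm_nonneg])
  finally show ?thesis .
qed

lemma total_variation_less:
  fixes f :: "int ^ 'd \<Rightarrow> real"
  assumes f: "f \<in> ell1" and pq: "f p \<noteq> 0" "f q \<noteq> 0" "p \<noteq> q"
  shows "total_variation (uncentered_maximal f) < ennreal (sharp_const CARD('d) * ell1_norm f)"
proof -
  \<comment> \<open>Any direction will do: a loss on one line is enough.\<close>
  fix i0 :: 'd
  define V where "V i y = (\<Sum>\<^sub>\<infinity>t. ennreal \<bar>uncentered_maximal f (y + axis i (t + 1))
    - uncentered_maximal f (y + axis i t)\<bar>)" for i y
  define y0 where "y0 = p - axis i0 (p $ i0)"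
  obtain \<eta> where \<eta>: "0 < \<eta>" "\<And>a b. a \<le> b \<Longrightarrow> (\<Sum>t\<in>{a..<b}. \<bar>uncentered_maximal f (y0 + axis i0 (t + 1))
      - uncentered_maximal f (y0 + axis i0 t)\<bar>) + \<eta> \<le> 2 * line_weight f i0 y0"
    using line_variation_less [OF f pq] unfolding y0_def by blast
  define \<epsilon> where "\<epsilon> i y = (if i = i0 \<and> y = y0 then \<eta> else 0)" for i y
  have V_le: "V i y + ennreal (\<epsilon> i y) \<le> ennreal (2 * line_weight f i y)" if y: "y $ i = 0" for i y
  proof -
    have "V i y \<le> ennreal (2 * line_weight f i y - \<epsilon> i y)"
      unfolding V_def
    proof (rule infsum_int_le)
      fix a b :: int assume ab: "a \<le> b"
      show "(\<Sum>t\<in>{a..<b}. \<bar>uncentered_maximal f (y + axis i (t + 1))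
          - uncentered_maximal f (y + axis i t)\<bar>) \<le> 2 * line_weight f i y - \<epsilon> i y"
      proof (cases "i = i0 \<and> y = y0")
        case True
        then show ?thesis using \<eta>(2) [OF ab] by (simp add: \<epsilon>_def)
      next
        case False
        then have "\<epsilon> i y = 0" by (auto simp: \<epsilon>_def)
        then show ?thesis using line_variation_le [OF f y ab] by simp
      qed
    qed simp
    then have "V i y + ennreal (\<epsilon> i y) \<le> ennreal (2 * line_weight f i y - \<epsilon> i y) + ennreal (\<epsilon> i y)"
      by (rule add_right_mono)
    also have "\<dots> = ennreal (2 * line_weight f i y)"
    proof (subst ennreal_plus [symmetric])
      \<comment> \<open>The empty interval shows that the difference is nonnegative, so
        \<open>ennreal\<close> does not truncate it.\<close>
      have "\<eta> \<le> 2 * line_weight f i0 y0" using \<eta>(2) [of 0 0] by simp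
      then show "0 \<le> 2 * line_weight f i y - \<epsilon> i y"
        using line_weight_nonneg [of f i y] by (auto simp: \<epsilon>_def)
      show "0 \<le> \<epsilon> i y" using \<eta>(1) by (simp add: \<epsilon>_def)
    qed simp
    finally show ?thesis .
  qed
  have y0: "y0 $ i0 = 0" by (simp add: y0_def axis_def)
  have "ennreal \<eta> = ennreal (\<epsilon> i0 y0)" by (simp add: \<epsilon>_def)
  also have "\<dots> = (\<Sum>\<^sub>\<infinity>y\<in>{y0}. ennreal (\<epsilon> i0 y))" by simp
  also have "\<dots> \<le> (\<Sum>\<^sub>\<infinity>y\<in>{y. y $ i0 = 0}. ennreal (\<epsilon> i0 y))"
    by (rule infsum_ennreal_mono2) (simp add: y0)
  also have "\<dots> \<le> (\<Sum>i\<in>(UNIV :: 'd set). \<Sum>\<^sub>\<infinity>y\<in>{y. y $ i = 0}. ennreal (\<epsilon> i y))"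
    by (rule member_le_sum) auto
  finally have "total_variation (uncentered_maximal f) + ennreal \<eta>
      \<le> (\<Sum>i\<in>(UNIV :: 'd set). \<Sum>\<^sub>\<infinity>y\<in>{y. y $ i = 0}. V i y)
        + (\<Sum>i\<in>(UNIV :: 'd set). \<Sum>\<^sub>\<infinity>y\<in>{y. y $ i = 0}. ennreal (\<epsilon> i y))"
    unfolding total_variation_lines V_def by (rule add_left_mono)
  also have "\<dots> = (\<Sum>i\<in>(UNIV :: 'd set). \<Sum>\<^sub>\<infinity>y\<in>{y. y $ i = 0}. V i y + ennreal (\<epsilon> i y))"
    unfolding sum.distrib [symmetric]
    by (intro sum.cong refl infsum_add [symmetric]) (auto intro: nonneg_summable_on_complete)
  also have "\<dots> \<le> (\<Sum>i\<in>(UNIV :: 'd set). \<Sum>\<^sub>\<infinity>y\<in>{y. y $ i = 0}. ennreal (2 * line_weight f i y))"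
    by (intro sum_mono infsum_mono V_le) (auto intro: nonneg_summable_on_complete)
  also have "\<dots> = ennreal (sharp_const CARD('d) * ell1_norm f)"
    by (simp only: infsum_line_weight [OF f] sharp_const_sum [OF ell1_norm_nonneg])
  finally have le: "total_variation (uncentered_maximal f) + ennreal \<eta>
    \<le> ennreal (sharp_const CARD('d) * ell1_norm f)" .
  have "total_variation (uncentered_maximal f) \<noteq> ennreal (sharp_const CARD('d) * ell1_norm f)"
  proof
    assume "total_variation (uncentered_maximal f) = ennreal (sharp_const CARD('d) * ell1_norm f)"
    with le have "ennreal (sharp_const CARD('d) * ell1_norm f) + ennreal \<eta>
      \<le> ennreal (sharp_const CARD('d) * ell1_norm f) + 0" by simp
    \<comment> \<open>Cancellation is allowed because the common summand is finite.\<close>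
    then have "ennreal \<eta> \<le> 0"
      by (simp only: ennreal_add_left_cancel_le) simp
    with \<eta>(1) show False by simp
  qed
  with total_variation_le [OF f] show ?thesis by simp
qed

theorem theorem3:
  shows "(\<forall>f :: int ^ 'd \<Rightarrow> real. f \<in> ell1 \<longrightarrow>
            total_variation (uncentered_maximal f)
              \<le> ennreal (sharp_const CARD('d) * ell1_norm f)) \<and>
         (\<forall>C :: real.
            (\<forall>f :: int ^ 'd \<Rightarrow> real. f \<in> ell1 \<longrightarrow>
               total_variation (uncentered_maximal f) \<le> ennreal (C * ell1_norm f))
            \<longrightarrow> sharp_const CARD('d) \<le> C) \<and>
         (\<forall>f :: int ^ 'd \<Rightarrow> real. f \<in> ell1 \<longrightarrow>
            (total_variation (uncentered_maximal f)
               = ennreal (sharp_const CARD('d) * ell1_norm f)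
             \<longleftrightarrow> delta_function f))"
proof (intro conjI allI impI)
  fix f :: "int ^ 'd \<Rightarrow> real" assume "f \<in> ell1"
  then show "total_variation (uncentered_maximal f) \<le> ennreal (sharp_const CARD('d) * ell1_norm f)"
    by (rule total_variation_le)
next
  fix C :: real
  assume C: "\<forall>f :: int ^ 'd \<Rightarrow> real. f \<in> ell1 \<longrightarrow>
    total_variation (uncentered_maximal f) \<le> ennreal (C * ell1_norm f)"
  \<comment> \<open>The unit mass at the origin witnesses optimality.\<close>
  define \<delta> :: "int ^ 'd \<Rightarrow> real" where "\<delta> n = (if n = 0 then 1 else 0)" for n
  have \<delta>: "\<forall>n. n \<noteq> 0 \<longrightarrow> \<delta> n = 0" by (simp add: \<delta>_def)
  have norm: "ell1_norm \<delta> = 1" unfolding delta_function_ell1(2) [OF \<delta>] by (simp add: \<delta>_def)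
  have "ennreal (sharp_const CARD('d)) \<le> total_variation (uncentered_maximal \<delta>)"
    using total_variation_delta_ge [OF \<delta>] by (simp add: norm)
  also have "\<dots> \<le> ennreal C"
    using C delta_function_ell1(1) [OF \<delta>] norm by force
  \<comment> \<open>\<open>ennreal C\<close> is 0 for negative \<open>C\<close>; positivity of the
    sharp constant excludes that case.\<close>
  finally show "sharp_const CARD('d) \<le> C"
    using sharp_const_pos [of "CARD('d)"] by (simp add: ennreal_le_iff2)
next
  fix f :: "int ^ 'd \<Rightarrow> real" assume f: "f \<in> ell1"
  show "total_variation (uncentered_maximal f) = ennreal (sharp_const CARD('d) * ell1_norm f)
      \<longleftrightarrow> delta_function f"
  proof
    assume eq: "total_variation (uncentered_maximal f) = ennreal (sharp_const CARD('d) * ell1_norm f)"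
    then have support: "p = q" if "f p \<noteq> 0" "f q \<noteq> 0" for p q
      using total_variation_less [OF f that] by auto
    show "delta_function f"
    proof (cases "\<exists>p. f p \<noteq> 0")
      case True
      then show ?thesis unfolding delta_function_def using support by blast
    next
      case False
      \<comment> \<open>The zero function counts as a delta function with value 0.\<close>
      then show ?thesis unfolding delta_function_def by auto
    qed
  next
    assume "delta_function f"
    then obtain p where "\<forall>n. n \<noteq> p \<longrightarrow> f n = 0" by (auto simp: delta_function_def)
    then show "total_variation (uncentered_maximal f) = ennreal (sharp_const CARD('d) * ell1_norm f)"
      by (intro antisym total_variation_le total_variation_delta_ge f)
  qed
qed

end
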